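(* Let $n\ge 1$ and consider the BAM neural network $$\frac{dx_i(t)}{dt}=r_i(t)\Bigl(-a_ix_i(h_i^{(1)}(t))+\sum_{j=1}^n a_{ij}f_j\bigl(y_j(l_j^{(2)}(t))\bigr)+I_i\Bigr),$$ $$\frac{dy_i(t)}{dt}=p_i(t)\Bigl(-b_iy_i(h_i^{(2)}(t))+\sum_{j=1}^n b_{ij}g_j\bigl(x_j(l_j^{(1)}(t))\bigr)+J_i\Bigr),\qquad i=1,\dots,n,$$ where $a_i>0$, $b_i>0$, $a_{ij},b_{ij},I_i,J_i\in\mathbb{R}$ are constants, under the assumptions: (i) $r_i,p_i$ are Lebesgue measurable essentially bounded functions on $[0,\infty)$ with $0<\alpha_i\le r_i(t)\le R_i$, $0<\beta_i\le p_i(t)\le P_i$; (ii) $f_j,g_j:\mathbb{R}\to\mathbb{R}$ satisfy $|f_j(u)-f_j(v)|\le L_j^f|u-v|$ and $|g_j(u)-g_j(v)|\le L_j^g|u-v|$ for all $u,v\in\mathbb{R}$; (iii) $h_i^{(k)},l_i^{(k)}$ ($k=1,2$) are Lebesgue measurable with $0\le t-h_i^{(k)}(t)\le\tau_i^{(k)}$ and $0\le t-l_i^{(k)}(t)\le\sigma_i^{(k)}$; (iv) the initial functions are continuous. Here $\alpha_i,R_i,\beta_i,P_i,L_j^f,L_j^g,\tau_i^{(k)},\sigma_i^{(k)}$ are constants. Assume that the system has a unique equilibrium $(x^\ast,y^\ast)$. Define the $2n\times 2n$ matrix $C_{BAM}=(c_{ij})_{i,j=1}^{2n}$ by $$c_{ii}=\begin{cases}1-\dfrac{a_iR_i^2\tau_i^{(1)}}{\alpha_i},&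 i=1,\dots,n,\\[2mm] 1-\dfrac{b_{i-n}P_{i-n}^2\tau_{i-n}^{(2)}}{\beta_{i-n}},& i=n+1,\dots,2n,\end{cases}$$ and, for $i\ne j$, $$c_{ij}=\begin{cases}-\dfrac{|a_{i,j-n}|R_iL_{j-n}^f\,(a_iR_i\tau_i^{(1)}+1)}{\alpha_ia_i},& i=1,\dots,n,\ j=n+1,\dots,2n,\\[2mm] -\dfrac{|b_{i-n,j}|P_{i-n}L_j^g\,(b_{i-n}P_{i-n}\tau_{i-n}^{(2)}+1)}{\beta_{i-n}b_{i-n}},& i=n+1,\dots,2n,\ j=1,\dots,n,\\[2mm] 0,&\text{otherwise.}\end{cases}$$ If $C_{BAM}$ is an $M$-matrix, then the equilibrium $(x^\ast,y^\ast)$ is globally exponentially stable.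
   Context: An equilibrium is a constant vector $(x^\ast,y^\ast)=(x_1^\ast,\dots,x_n^\ast,y_1^\ast,\dots,y_n^\ast)$ with $a_ix_i^\ast=\sum_{j=1}^n a_{ij}f_j(y_j^\ast)+I_i$ and $b_iy_i^\ast=\sum_{j=1}^n b_{ij}g_j(x_j^\ast)+J_i$ for $i=1,\dots,n$. $M$-matrix: a real square matrix $B=(b_{ij})$ is a (nonsingular) $M$-matrix if $b_{ij}\le 0$ for $i\ne j$ and all principal minors of $B$ are positive (equivalently, given the sign condition, $B$ is invertible with entrywise nonnegative inverse). Solutions: let $\sigma$ be the maximum of all $\tau_i^{(k)},\sigma_i^{(k)}$. For $t_0\ge 0$ and continuous $\varphi=(\varphi_1,\dots,\varphi_{2n}):[t_0-\sigma,t_0]\to\mathbb{R}^{2n}$, the solution $Z(t)=(x_1,\dots,x_n,y_1,\dots,y_n)(t)$ is locally absolutely continuous on $[t_0,\infty)$, satisfies the system for almost every $t>t_0$, and $x_i=\varphi_i$, $y_i=\varphi_{i+n}$ on $[t_0-\sigma,t_0]$. Global exponential stability of the equilibrium $Z^\ast=(x^\ast,y^\ast)$: there exist $M>0$, $\lambda>0$, not depending on $t_0$, such that for all $t_0\ge0$ and all initial functions $\varphi$, $$\|Z(t)-Z^\ast\|\le Me^{-\lambda(t-t_0)}\Bigl(\|Z(t_0)-Z^\ast\|+\sup_{t_0-\sigma\le s<t_0}\|\varphi(s)-Z^\ast\|\Bigr),\qquad t\ge t_0,$$ where $\|\cdot\|$ is a fixed norm on $\mathbb{R}^{2n}$ (the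 supremum over an empty set is read as $0$). *)

theory Defs
  imports "HOL-Analysis.Analysis"
begin

section \<open>Absolutely continuous functions, norms, and M-matrices\<close>

definition absolutely_continuous_fun_on :: "real set \<Rightarrow> (real \<Rightarrow> 'a::real_normed_vector) \<Rightarrow> bool" where
  "absolutely_continuous_fun_on S F \<longleftrightarrow>
     (\<forall>\<epsilon>>0. \<exists>\<delta>>0. \<forall>(m::nat) (u::nat \<Rightarrow> real) (v::nat \<Rightarrow> real).
        (\<forall>k<m. u k \<le> v k \<and> {u k..v k} \<subseteq> S) \<longrightarrow>
        disjoint_family_on (\<lambda>k. {u k<..<v k}) {..<m} \<longrightarrow>
        (\<Sum>k<m. v k - u k) < \<delta> \<longrightarrow>
        (\<Sum>k<m. norm (F (v k) - F (u k))) < \<epsilon>)"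

definition locally_absolutely_continuous_from :: "real \<Rightarrow> (real \<Rightarrow> 'a::real_normed_vector) \<Rightarrow> bool" where
  "locally_absolutely_continuous_from t0 F \<longleftrightarrow>
     (\<forall>T\<ge>t0. absolutely_continuous_fun_on {t0..T} F)"

definition is_norm :: "('a::real_vector \<Rightarrow> real) \<Rightarrow> bool" where
  "is_norm N \<longleftrightarrow>
     (\<forall>x. 0 \<le> N x) \<and> (\<forall>x. N x = 0 \<longleftrightarrow> x = 0) \<and>
     (\<forall>c x. N (c *\<^sub>R x) = \<bar>c\<bar> * N x) \<and> (\<forall>x y. N (x + y) \<le> N x + N y)"

text \<open>The determinant of the submatrix with rows and columns in \<open>S\<close>.  The dimension of a
  matrix is a type, so the Leibniz sum by which the library defines \<^const>\<open>det\<close> is taken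
  over the permutations of \<open>S\<close>.\<close>

definition principal_minor :: "real^'m^'m \<Rightarrow> 'm set \<Rightarrow> real" where
  "principal_minor A S =
     (\<Sum>p | p permutes S. of_int (sign p) * (\<Prod>i\<in>S. A $ i $ p i))"

lemma principal_minor_UNIV: "principal_minor A UNIV = det A"
  by (simp add: principal_minor_def det_def)

lemma principal_minor_singleton: "principal_minor A {i} = A $ i $ i"
  by (simp add: principal_minor_def)

definition M_matrix :: "real^'m^'m \<Rightarrow> bool" where
  "M_matrix A \<longleftrightarrow>
     (\<forall>i j. i \<noteq> j \<longrightarrow> A $ i $ j \<le> 0) \<and> (\<forall>S. S \<noteq> {} \<longrightarrow> principal_minor A S > 0)"

section \<open>The BAM network\<close>

text \<open>States are vectors \<open>Z\<close> indexed by \<^typ>\<open>'n + 'n\<close>, with \<open>Z $ Inl i\<close> the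
  component \<open>x\<^sub>i\<close> and \<open>Z $ Inr i\<close> the component \<open>y\<^sub>i\<close>; the index \<open>Inr i\<close> plays
  the role of \<open>n + i\<close>.  The connection weights \<open>a\<^sub>i\<^sub>j\<close> and \<open>b\<^sub>i\<^sub>j\<close> are \<open>A i j\<close> and
  \<open>B i j\<close>, and superscripts \<open>(1)\<close>, \<open>(2)\<close> are rendered by suffixes.\<close>

definition bam_equilibrium ::
  "('n::finite \<Rightarrow> real) \<Rightarrow> ('n \<Rightarrow> real) \<Rightarrow> ('n \<Rightarrow> 'n \<Rightarrow> real) \<Rightarrow> ('n \<Rightarrow> 'n \<Rightarrow> real) \<Rightarrow>
   ('n \<Rightarrow> real \<Rightarrow> real) \<Rightarrow> ('n \<Rightarrow> real \<Rightarrow> real) \<Rightarrow> ('n \<Rightarrow> real) \<Rightarrow> ('n \<Rightarrow> real) \<Rightarrow>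
   real^('n + 'n) \<Rightarrow> bool" where
  "bam_equilibrium a b A B f g I J Z \<longleftrightarrow>
     (\<forall>i. a i * Z $ Inl i = (\<Sum>j\<in>UNIV. A i j * f j (Z $ Inr j)) + I i) \<and>
     (\<forall>i. b i * Z $ Inr i = (\<Sum>j\<in>UNIV. B i j * g j (Z $ Inl j)) + J i)"

definition bam_solution ::
  "('n::finite \<Rightarrow> real \<Rightarrow> real) \<Rightarrow> ('n \<Rightarrow> real \<Rightarrow> real) \<Rightarrow>
   ('n \<Rightarrow> real) \<Rightarrow> ('n \<Rightarrow> real) \<Rightarrow> ('n \<Rightarrow> 'n \<Rightarrow> real) \<Rightarrow> ('n \<Rightarrow> 'n \<Rightarrow> real) \<Rightarrow>
   ('n \<Rightarrow> real \<Rightarrow> real) \<Rightarrow> ('n \<Rightarrow> real \<Rightarrow> real) \<Rightarrow> ('n \<Rightarrow> real) \<Rightarrow> ('n \<Rightarrow> real) \<Rightarrow>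
   ('n \<Rightarrow> real \<Rightarrow> real) \<Rightarrow> ('n \<Rightarrow> real \<Rightarrow> real) \<Rightarrow> ('n \<Rightarrow> real \<Rightarrow> real) \<Rightarrow> ('n \<Rightarrow> real \<Rightarrow> real) \<Rightarrow>
   real \<Rightarrow> real \<Rightarrow> (real \<Rightarrow> real^('n + 'n)) \<Rightarrow> (real \<Rightarrow> real^('n + 'n)) \<Rightarrow> bool" where
  "bam_solution r p a b A B f g I J h1 h2 l1 l2 \<sigma> t0 \<phi> Z \<longleftrightarrow>
     locally_absolutely_continuous_from t0 Z \<and>
     (AE t in lebesgue. t > t0 \<longrightarrow>
        (\<forall>i. ((\<lambda>s. Z s $ Inl i) has_real_derivative
               r i t * (- a i * Z (h1 i t) $ Inl i
                        + (\<Sum>j\<in>UNIV. A i j * f j (Z (l2 j t) $ Inr j)) + I i)) (at t)) \<and>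
        (\<forall>i. ((\<lambda>s. Z s $ Inr i) has_real_derivative
               p i t * (- b i * Z (h2 i t) $ Inr i
                        + (\<Sum>j\<in>UNIV. B i j * g j (Z (l1 j t) $ Inl j)) + J i)) (at t))) \<and>
     (\<forall>s\<in>{t0 - \<sigma>..t0}. Z s = \<phi> s)"

definition max_delay ::
  "('n::finite \<Rightarrow> real) \<Rightarrow> ('n \<Rightarrow> real) \<Rightarrow> ('n \<Rightarrow> real) \<Rightarrow> ('n \<Rightarrow> real) \<Rightarrow> real" where
  "max_delay \<tau>1 \<tau>2 \<sigma>1 \<sigma>2 = Max (range \<tau>1 \<union> range \<tau>2 \<union> range \<sigma>1 \<union> range \<sigma>2)"

text \<open>\<open>Sol t0 \<phi> Z\<close> says that \<open>Z\<close> is the solution with initial time \<open>t0\<close> and initial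
  function \<open>\<phi>\<close>.  The case distinction is needed because \<^term>\<open>Sup {} :: real\<close> is
  unspecified; the interval is empty when there is no delay.\<close>

definition globally_exponentially_stable ::
  "('a::real_normed_vector \<Rightarrow> real) \<Rightarrow> real \<Rightarrow>
   (real \<Rightarrow> (real \<Rightarrow> 'a) \<Rightarrow> (real \<Rightarrow> 'a) \<Rightarrow> bool) \<Rightarrow> 'a \<Rightarrow> bool" where
  "globally_exponentially_stable N \<sigma> Sol Zs \<longleftrightarrow>
     (\<exists>M>0. \<exists>\<gamma>>0. \<forall>t0\<ge>0. \<forall>\<phi> Z.
        continuous_on {t0 - \<sigma>..t0} \<phi> \<longrightarrow> Sol t0 \<phi> Z \<longrightarrow>
        (\<forall>t\<ge>t0. N (Z t - Zs) \<le> M * exp (- \<gamma> * (t - t0)) *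
           (N (Z t0 - Zs) +
            (if {t0 - \<sigma>..<t0} = {} then 0 else (SUP s\<in>{t0 - \<sigma>..<t0}. N (\<phi> s - Zs))))))"

definition C_BAM ::
  "('n::finite \<Rightarrow> real) \<Rightarrow> ('n \<Rightarrow> real) \<Rightarrow> ('n \<Rightarrow> 'n \<Rightarrow> real) \<Rightarrow> ('n \<Rightarrow> 'n \<Rightarrow> real) \<Rightarrow>
   ('n \<Rightarrow> real) \<Rightarrow> ('n \<Rightarrow> real) \<Rightarrow> ('n \<Rightarrow> real) \<Rightarrow> ('n \<Rightarrow> real) \<Rightarrow> ('n \<Rightarrow> real) \<Rightarrow> ('n \<Rightarrow> real) \<Rightarrow>
   ('n \<Rightarrow> real) \<Rightarrow> ('n \<Rightarrow> real) \<Rightarrow> real^('n + 'n)^('n + 'n)" where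
  "C_BAM a b A B \<alpha> R \<beta> P Lf Lg \<tau>1 \<tau>2 =
     (\<chi> i j. case (i, j) of
        (Inl i, Inl j) \<Rightarrow> if i = j then 1 - a i * (R i)\<^sup>2 * \<tau>1 i / \<alpha> i else 0
      | (Inr i, Inr j) \<Rightarrow> if i = j then 1 - b i * (P i)\<^sup>2 * \<tau>2 i / \<beta> i else 0
      | (Inl i, Inr j) \<Rightarrow> - (\<bar>A i j\<bar> * R i * Lf j * (a i * R i * \<tau>1 i + 1) / (\<alpha> i * a i))
      | (Inr i, Inl j) \<Rightarrow> - (\<bar>B i j\<bar> * P i * Lg j * (b i * P i * \<tau>2 i + 1) / (\<beta> i * b i)))"

end

theory Submission
  imports Defs
begin

text \<open>The deviation \<open>u = Z - Z\<^sup>*\<close> from the equilibrium satisfies, component by component,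
  \<open>u\<^sub>k' = \<rho> (- d\<^sub>k u\<^sub>k(\<theta>) + F)\<close>, where \<open>F\<close> is bounded by a weighted sum \<open>\<Sum>\<^sub>j w\<^sub>k\<^sub>j \<bar>u\<^sub>j\<bar>\<close> of delayed
  values.  Writing \<open>u\<^sub>k(\<theta>) = u\<^sub>k(t) - (u\<^sub>k(t) - u\<^sub>k(\<theta>))\<close> exhibits the damping \<open>- d\<^sub>k u\<^sub>k(t)\<close>, and the
  difference is at most the delay \<open>\<tau>\<^sub>k\<close> times the speed of \<open>u\<^sub>k\<close>, which the equation bounds again.
  If all \<open>\<bar>u\<^sub>j\<bar>\<close> are at most \<open>\<xi>\<^sub>j\<close>, the damping wins at \<open>\<bar>u\<^sub>k\<bar> = \<xi>\<^sub>k\<close> provided that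
  \<open>d\<^sub>k R\<^sub>k \<tau>\<^sub>k (d\<^sub>k \<xi>\<^sub>k + q\<^sub>k) + q\<^sub>k < d\<^sub>k \<xi>\<^sub>k\<close> with \<open>q\<^sub>k = \<Sum>\<^sub>j w\<^sub>k\<^sub>j \<xi>\<^sub>j\<close>.

  An M-matrix maps some positive vector \<open>\<xi>\<close> to a positive vector (\<open>M_matrix_positive_vector\<close>), and
  for \<open>C\<^sub>B\<^sub>A\<^sub>M\<close> this gives the displayed inequality (\<open>positive_vector_dominance\<close>).  The inequality is strict, so it leaves
  room for a barrier \<open>B \<xi>\<^sub>k exp (- \<mu> (t - t\<^sub>0))\<close> that shrinks at a small rate \<open>\<mu> > 0\<close>.  No component can be the
  first to reach its barrier (\<open>delayed_feedback_weighted_bound\<close>), and the barrier height \<open>B\<close> is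
  proportional to the size of the initial data, with a factor that does not depend on \<open>t\<^sub>0\<close>.

  Solutions are merely absolutely continuous and satisfy the equation almost everywhere.  The one
  fact of real analysis needed about them is that an absolutely continuous function with
  nonpositive derivative almost everywhere is nonincreasing (\<open>absolutely_continuous_nonincreasing\<close>).\<close>

section \<open>Monotonicity of absolutely continuous functions\<close>

lemma absolutely_continuous_fun_on_subset:
  assumes "absolutely_continuous_fun_on T F" "S \<subseteq> T"
  shows "absolutely_continuous_fun_on S F"
  using assms unfolding absolutely_continuous_fun_on_def by (meson subset_trans)

text \<open>The definition of absolute continuity numbers the intervals by \<open>{..<m}\<close>.  Tagged divisions
  produce finite sets of intervals, so the bound is transferred to an arbitrary finite index set.\<close>

lemma absolutely_continuous_fun_on_finite_family:
  assumes "absolutely_continuous_fun_on S F" "e > 0"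
  obtains d where "d > 0"
    "\<And>(p::'i set) lo hi. \<lbrakk>finite p; \<And>i. i \<in> p \<Longrightarrow> lo i \<le> hi i \<and> {lo i..hi i} \<subseteq> S;
       disjoint_family_on (\<lambda>i. {lo i<..<hi i}) p; (\<Sum>i\<in>p. hi i - lo i) < d\<rbrakk>
       \<Longrightarrow> (\<Sum>i\<in>p. norm (F (hi i) - F (lo i))) < e"
proof -
  have "\<exists>d>0. \<forall>(m::nat) u v. (\<forall>k<m. u k \<le> v k \<and> {u k..v k} \<subseteq> S) \<longrightarrow>
      disjoint_family_on (\<lambda>k. {u k<..<v k}) {..<m} \<longrightarrow> (\<Sum>k<m. v k - u k) < d \<longrightarrow>
      (\<Sum>k<m. norm (F (v k) - F (u k))) < e"
    using assms unfolding absolutely_continuous_fun_on_def by blast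
  then obtain d where d: "d > 0" and
    *: "\<forall>(m::nat) u v. (\<forall>k<m. u k \<le> v k \<and> {u k..v k} \<subseteq> S) \<longrightarrow>
      disjoint_family_on (\<lambda>k. {u k<..<v k}) {..<m} \<longrightarrow> (\<Sum>k<m. v k - u k) < d \<longrightarrow>
      (\<Sum>k<m. norm (F (v k) - F (u k))) < e"
    by blast
  have "(\<Sum>i\<in>p. norm (F (hi i) - F (lo i))) < e"
    if fin: "finite p" and inS: "\<And>i. i \<in> p \<Longrightarrow> lo i \<le> hi i \<and> {lo i..hi i} \<subseteq> S"
      and disj: "disjoint_family_on (\<lambda>i. {lo i<..<hi i}) p" and len: "(\<Sum>i\<in>p. hi i - lo i) < d"
    for p :: "'i set" and lo hi
  proof -
    obtain h where h: "bij_betw h {..<card p} p"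
      using ex_bij_betw_nat_finite[OF fin] atLeast0LessThan by metis
    have hp: "h k \<in> p" if "k < card p" for k using h that by (auto simp: bij_betw_def)
    have "(\<Sum>k<card p. norm (F (hi (h k)) - F (lo (h k)))) < e"
    proof (rule *[rule_format])
      show "lo (h k) \<le> hi (h k) \<and> {lo (h k)..hi (h k)} \<subseteq> S" if "k < card p" for k
        using hp[OF that] inS by blast
      show "disjoint_family_on (\<lambda>k. {lo (h k)<..<hi (h k)}) {..<card p}"
        using disj hp h unfolding disjoint_family_on_def bij_betw_def inj_on_def by (metis lessThan_iff)
      show "(\<Sum>k<card p. hi (h k) - lo (h k)) < d"
        using len sum.reindex_bij_betw[OF h, of "\<lambda>i. hi i - lo i"] by simp
    qed
    then show ?thesis using sum.reindex_bij_betw[OF h, of "\<lambda>i. norm (F (hi i) - F (lo i))"] by simp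
  qed
  with d that show thesis by blast
qed

lemma absolutely_continuous_fun_on_lipschitz:
  assumes "\<And>x y. x \<in> S \<Longrightarrow> y \<in> S \<Longrightarrow> norm (F x - F y) \<le> L * \<bar>x - y\<bar>"
  shows "absolutely_continuous_fun_on S F"
  unfolding absolutely_continuous_fun_on_def
proof (intro allI impI)
  fix e :: real assume "e > 0"
  define d where "d = e / (\<bar>L\<bar> + 1)"
  have "d > 0" using \<open>e > 0\<close> by (simp add: d_def add_nonneg_pos)
  moreover have "(\<Sum>k<m. norm (F (v k) - F (u k))) < e"
    if uv: "\<forall>k<m. u k \<le> v k \<and> {u k..v k} \<subseteq> S" and s: "(\<Sum>k<m. v k - u k) < d"
    for m :: nat and u v
  proof -
    have "norm (F (v k) - F (u k)) \<le> (\<bar>L\<bar> + 1) * (v k - u k)" if "k < m" for k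
    proof -
      have "u k \<le> v k" "u k \<in> S" "v k \<in> S"
        using uv that by (auto dest!: spec[of _ k])
      then have "norm (F (v k) - F (u k)) \<le> L * (v k - u k)"
        using assms[of "v k" "u k"] by simp
      also have "\<dots> \<le> (\<bar>L\<bar> + 1) * (v k - u k)"
        using \<open>u k \<le> v k\<close> by (intro mult_right_mono) auto
      finally show ?thesis .
    qed
    then have "(\<Sum>k<m. norm (F (v k) - F (u k))) \<le> (\<Sum>k<m. (\<bar>L\<bar> + 1) * (v k - u k))"
      by (intro sum_mono) auto
    also have "\<dots> = (\<bar>L\<bar> + 1) * (\<Sum>k<m. v k - u k)" by (simp add: sum_distrib_left)
    also have "\<dots> < (\<bar>L\<bar> + 1) * d" using s by (intro mult_strict_left_mono) auto
    also have "\<dots> = e" by (simp add: d_def)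
    finally show ?thesis .
  qed
  ultimately show "\<exists>d>0. \<forall>(m::nat) u v. (\<forall>k<m. u k \<le> v k \<and> {u k..v k} \<subseteq> S) \<longrightarrow>
      disjoint_family_on (\<lambda>k. {u k<..<v k}) {..<m} \<longrightarrow> (\<Sum>k<m. v k - u k) < d \<longrightarrow>
      (\<Sum>k<m. norm (F (v k) - F (u k))) < e" by blast
qed

lemma absolutely_continuous_fun_on_bounded_linear:
  assumes "absolutely_continuous_fun_on S F" "bounded_linear h"
  shows "absolutely_continuous_fun_on S (\<lambda>x. h (F x))"
  unfolding absolutely_continuous_fun_on_def
proof (intro allI impI)
  fix e :: real assume "e > 0"
  interpret bounded_linear h by fact
  obtain B where B: "B > 0" "\<And>x. norm (h x) \<le> norm x * B" using pos_bounded by blast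
  obtain d where d: "d > 0" and
    *: "\<And>(p::nat set) u v. \<lbrakk>finite p; \<And>k. k \<in> p \<Longrightarrow> u k \<le> v k \<and> {u k..v k} \<subseteq> S;
      disjoint_family_on (\<lambda>k. {u k<..<v k}) p; (\<Sum>k\<in>p. v k - u k) < d\<rbrakk>
      \<Longrightarrow> (\<Sum>k\<in>p. norm (F (v k) - F (u k))) < e / B"
    using absolutely_continuous_fun_on_finite_family[OF assms(1) divide_pos_pos[OF \<open>e > 0\<close> B(1)]] by blast
  have "(\<Sum>k<m. norm (h (F (v k)) - h (F (u k)))) < e"
    if "\<forall>k<m. u k \<le> v k \<and> {u k..v k} \<subseteq> S" "disjoint_family_on (\<lambda>k. {u k<..<v k}) {..<m}"
      "(\<Sum>k<m. v k - u k) < d" for m :: nat and u v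
  proof -
    have "(\<Sum>k<m. norm (h (F (v k)) - h (F (u k)))) \<le> (\<Sum>k<m. norm (F (v k) - F (u k)) * B)"
      by (intro sum_mono) (metis B(2) diff)
    also have "\<dots> = (\<Sum>k<m. norm (F (v k) - F (u k))) * B" by (simp add: sum_distrib_right)
    also have "\<dots> < e / B * B" using *[of "{..<m}" u v] that B(1) by (intro mult_strict_right_mono) auto
    finally show ?thesis using B(1) by simp
  qed
  with d show "\<exists>d>0. \<forall>(m::nat) u v. (\<forall>k<m. u k \<le> v k \<and> {u k..v k} \<subseteq> S) \<longrightarrow>
      disjoint_family_on (\<lambda>k. {u k<..<v k}) {..<m} \<longrightarrow> (\<Sum>k<m. v k - u k) < d \<longrightarrow>
      (\<Sum>k<m. norm (h (F (v k)) - h (F (u k)))) < e" by blast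
qed

lemma absolutely_continuous_fun_on_diff:
  assumes "absolutely_continuous_fun_on S F" "absolutely_continuous_fun_on S G"
  shows "absolutely_continuous_fun_on S (\<lambda>x. F x - G x)"
  unfolding absolutely_continuous_fun_on_def
proof (intro allI impI)
  fix e :: real assume "e > 0"
  obtain d where d: "d > 0" and
    dF: "\<And>(p::nat set) u v. \<lbrakk>finite p; \<And>k. k \<in> p \<Longrightarrow> u k \<le> v k \<and> {u k..v k} \<subseteq> S;
      disjoint_family_on (\<lambda>k. {u k<..<v k}) p; (\<Sum>k\<in>p. v k - u k) < d\<rbrakk>
      \<Longrightarrow> (\<Sum>k\<in>p. norm (F (v k) - F (u k))) < e / 2"
    using absolutely_continuous_fun_on_finite_family[OF assms(1) half_gt_zero[OF \<open>e > 0\<close>]] by blast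
  obtain d' where d': "d' > 0" and
    dG: "\<And>(p::nat set) u v. \<lbrakk>finite p; \<And>k. k \<in> p \<Longrightarrow> u k \<le> v k \<and> {u k..v k} \<subseteq> S;
      disjoint_family_on (\<lambda>k. {u k<..<v k}) p; (\<Sum>k\<in>p. v k - u k) < d'\<rbrakk>
      \<Longrightarrow> (\<Sum>k\<in>p. norm (G (v k) - G (u k))) < e / 2"
    using absolutely_continuous_fun_on_finite_family[OF assms(2) half_gt_zero[OF \<open>e > 0\<close>]] by blast
  have "(\<Sum>k<m. norm ((F (v k) - G (v k)) - (F (u k) - G (u k)))) < e"
    if "\<forall>k<m. u k \<le> v k \<and> {u k..v k} \<subseteq> S" "disjoint_family_on (\<lambda>k. {u k<..<v k}) {..<m}"
      "(\<Sum>k<m. v k - u k) < min d d'" for m :: nat and u v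
  proof -
    have "(\<Sum>k<m. norm ((F (v k) - G (v k)) - (F (u k) - G (u k)))) \<le>
        (\<Sum>k<m. norm (F (v k) - F (u k)) + norm (G (v k) - G (u k)))"
      using norm_triangle_ineq4[of "F (v k) - F (u k)" "G (v k) - G (u k)" for k]
      by (intro sum_mono) (simp add: algebra_simps)
    also have "\<dots> < e / 2 + e / 2"
      unfolding sum.distrib using dF[of "{..<m}" u v] dG[of "{..<m}" u v] that by (intro add_strict_mono) auto
    finally show ?thesis by simp
  qed
  with d d' show "\<exists>d>0. \<forall>(m::nat) u v. (\<forall>k<m. u k \<le> v k \<and> {u k..v k} \<subseteq> S) \<longrightarrow>
      disjoint_family_on (\<lambda>k. {u k<..<v k}) {..<m} \<longrightarrow> (\<Sum>k<m. v k - u k) < d \<longrightarrow>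
      (\<Sum>k<m. norm ((F (v k) - G (v k)) - (F (u k) - G (u k)))) < e"
    by (intro exI[of _ "min d d'"]) auto
qed

lemma absolutely_continuous_fun_on_imp_continuous_on:
  assumes "absolutely_continuous_fun_on {a..b} F"
  shows "continuous_on {a..b} F"
  unfolding continuous_on_iff
proof (intro ballI allI impI)
  fix x e :: real assume x: "x \<in> {a..b}" and "e > 0"
  then obtain d where d: "d > 0" and
    *: "\<And>(p::nat set) u v. \<lbrakk>finite p; \<And>k. k \<in> p \<Longrightarrow> u k \<le> v k \<and> {u k..v k} \<subseteq> {a..b};
      disjoint_family_on (\<lambda>k. {u k<..<v k}) p; (\<Sum>k\<in>p. v k - u k) < d\<rbrakk>
      \<Longrightarrow> (\<Sum>k\<in>p. norm (F (v k) - F (u k))) < e"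
    using absolutely_continuous_fun_on_finite_family[OF assms(1) \<open>e > 0\<close>] by blast
  have "dist (F y) (F x) < e" if y: "y \<in> {a..b}" "dist y x < d" for y
  proof (cases "x \<le> y")
    case True
    then show ?thesis using *[of "{0}" "\<lambda>_. x" "\<lambda>_. y"] x y
      by (auto simp: disjoint_family_on_def dist_norm)
  next
    case False
    then show ?thesis using *[of "{0}" "\<lambda>_. y" "\<lambda>_. x"] x y
      by (auto simp: disjoint_family_on_def dist_norm norm_minus_commute)
  qed
  with d show "\<exists>d>0. \<forall>x'\<in>{a..b}. dist x' x < d \<longrightarrow> dist (F x') (F x) < e" by blast
qed

text \<open>Choose a gauge that, at a point where the derivative exists, keeps the increment of \<open>F\<close> over
  an interval of length \<open>l\<close> below \<open>c l\<close>, and that, at a point of the exceptional null set \<open>E\<close>,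
  confines the interval to an open set of measure less than the \<open>\<delta>\<close> of absolute continuity.  In a
  fine tagged division of \<open>{a..b}\<close> the intervals of the first kind contribute at most
  \<open>c (b - a)\<close>, and those of the second kind contribute little because their total length is below
  \<open>\<delta>\<close>.\<close>

lemma absolutely_continuous_nonincreasing:
  fixes F :: "real \<Rightarrow> real"
  assumes "a \<le> b" and ac: "absolutely_continuous_fun_on {a..b} F"
    and der: "AE x in lebesgue. a < x \<and> x < b \<longrightarrow> (\<exists>D\<le>0. (F has_real_derivative D) (at x))"
  shows "F b \<le> F a"
proof (rule field_le_epsilon)
  fix e :: real assume "e > 0"
  define c where "c = e / 2 / (b - a + 1)"
  have "c > 0" using \<open>e > 0\<close> \<open>a \<le> b\<close> by (simp add: c_def)
  have cba: "c * (b - a) \<le> e / 2"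
    using \<open>e > 0\<close> \<open>a \<le> b\<close> by (simp add: c_def field_simps)
  obtain d where d: "d > 0" and acd:
    "\<And>(p::(real \<times> real set) set) lo hi. \<lbrakk>finite p; \<And>i. i \<in> p \<Longrightarrow> lo i \<le> hi i \<and> {lo i..hi i} \<subseteq> {a..b};
       disjoint_family_on (\<lambda>i. {lo i<..<hi i}) p; (\<Sum>i\<in>p. hi i - lo i) < d\<rbrakk>
       \<Longrightarrow> (\<Sum>i\<in>p. norm (F (hi i) - F (lo i))) < e / 2"
    using absolutely_continuous_fun_on_finite_family[OF ac half_gt_zero[OF \<open>e > 0\<close>]] by blast
  define good where "good x \<longleftrightarrow> (\<exists>D\<le>0. (F has_real_derivative D) (at x))" for x
  obtain N where N: "negligible N" "{x. \<not> (a < x \<and> x < b \<longrightarrow> good x)} \<subseteq> N"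
    using der unfolding eventually_ae_filter_negligible good_def by blast
  \<comment> \<open>The derivative is only assumed inside the interval, so the end points are exceptional too.\<close>
  define E where "E = N \<union> {a, b}"
  have "negligible E" using N(1) by (simp add: E_def negligible_Un)
  have goodE: "good x" if "x \<in> {a..b}" "x \<notin> E" for x
    using that N(2) by (force simp: E_def)
  obtain O' where O': "open O'" "E \<subseteq> O'" "O' - E \<in> lmeasurable" "emeasure lebesgue (O' - E) < ennreal d"
    using sets_lebesgue_outer_open[OF _ d, of E] \<open>negligible E\<close> by (metis negligible_imp_sets)
  have OE: "O' = (O' - E) \<union> E" using O'(2) by blast
  have Om: "O' \<in> lmeasurable"
    using O'(3) \<open>negligible E\<close> OE by (metis fmeasurable.Un negligible_iff_measure)
  have Olt: "measure lebesgue O' < d"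
  proof -
    have "measure lebesgue O' = measure lebesgue (O' - E)"
      using \<open>negligible E\<close> Om by (simp add: measure_Diff_null_set negligible_iff_null_sets fmeasurableD)
    then show ?thesis
      using O'(3,4) d by (simp add: emeasure_eq_measure2 ennreal_less_iff)
  qed
  have "\<exists>s>0. \<forall>u v. u \<le> x \<longrightarrow> x \<le> v \<longrightarrow> x - s < u \<longrightarrow> v < x + s \<longrightarrow> F v - F u \<le> c * (v - u)"
    if gx: "good x" for x
  proof -
    obtain D where D: "D \<le> 0" "(F has_derivative (\<lambda>h. D * h)) (at x)"
      using gx unfolding good_def has_field_derivative_def by blast
    then obtain s where s: "s > 0" "\<And>y. norm (y - x) < s \<Longrightarrow> norm (F y - F x - D * (y - x)) \<le> c * norm (y - x)"
      using \<open>c > 0\<close> unfolding has_derivative_at_alt by blast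
    have "F v - F u \<le> c * (v - u)" if "u \<le> x" "x \<le> v" "x - s < u" "v < x + s" for u v
    proof -
      have "F v - F x - D * (v - x) \<le> c * (v - x)"
        using s(2)[of v] that by auto
      moreover have "- (F u - F x - D * (u - x)) \<le> c * (x - u)"
        using s(2)[of u] that by auto
      moreover have "D * (v - x) \<le> 0" "D * (u - x) \<ge> 0"
        using D(1) that by (auto simp: mult_nonpos_nonneg mult_nonpos_nonpos)
      ultimately show ?thesis by (simp add: algebra_simps)
    qed
    with s(1) show ?thesis by blast
  qed
  then obtain s where s: "\<And>x. good x \<Longrightarrow> s x > 0"
    "\<And>x u v. good x \<Longrightarrow> u \<le> x \<Longrightarrow> x \<le> v \<Longrightarrow> x - s x < u \<Longrightarrow> v < x + s x \<Longrightarrow> F v - F u \<le> c * (v - u)"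
    by metis
  define \<gamma> where "\<gamma> x = (if x \<in> E then O' else if good x then ball x (s x) else UNIV)" for x
  have "gauge \<gamma>" unfolding gauge_def \<gamma>_def using O'(1,2) s(1) by auto
  then obtain p where p: "p tagged_division_of {a..b}" "\<gamma> fine p"
    using fine_division_exists_real by blast
  note pD = tagged_division_ofD[OF p(1)]
  have int: "x \<in> K \<and> K = {Inf K..Sup K} \<and> Inf K \<le> x \<and> x \<le> Sup K \<and> K \<subseteq> {a..b} \<and> K \<subseteq> \<gamma> x"
    if xK: "(x, K) \<in> p" for x K
  proof -
    obtain u v where "K = {u..v}" using pD(4)[OF xK] by auto
    moreover have "x \<in> K" using pD(2)[OF xK] .
    ultimately show ?thesis using pD(3)[OF xK] fineD[OF p(2) xK] by auto
  qed
  define q where "q = {t \<in> p. fst t \<in> E}"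
  have qp: "q \<subseteq> p" and finq: "finite q" using pD(1) by (auto simp: q_def)
  let ?lo = "\<lambda>t::real \<times> real set. Inf (snd t)" and ?hi = "\<lambda>t::real \<times> real set. Sup (snd t)"
  have disj: "disjoint_family_on (\<lambda>t. {?lo t<..<?hi t}) q"
    unfolding disjoint_family_on_def
  proof (intro ballI impI)
    fix t t' assume t: "t \<in> q" "t' \<in> q" "t \<noteq> t'"
    obtain x K x' K' where tt: "t = (x, K)" "t' = (x', K')" by fastforce
    have in_p: "(x, K) \<in> p" "(x', K') \<in> p" "(x, K) \<noteq> (x', K')" using t tt qp by auto
    have "interior K = {Inf K<..<Sup K}" "interior K' = {Inf K'<..<Sup K'}"
      using int[OF in_p(1)] int[OF in_p(2)] by (metis interior_atLeastAtMost_real)+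
    then show "{?lo t<..<?hi t} \<inter> {?lo t'<..<?hi t'} = {}"
      using pD(5)[OF in_p] tt by simp
  qed
  have len: "(\<Sum>t\<in>q. ?hi t - ?lo t) < d"
  proof -
    have "(\<Sum>t\<in>q. ?hi t - ?lo t) = (\<Sum>t\<in>q. measure lebesgue {?lo t<..<?hi t})"
      using int qp by (intro sum.cong) (force simp: prod.split)+
    also have "\<dots> = measure lebesgue (\<Union>t\<in>q. {?lo t<..<?hi t})"
      using disj finq by (intro measure_UNION'[symmetric])
        (auto simp: pairwise_def disjnt_def disjoint_family_on_def)
    also have "\<dots> \<le> measure lebesgue O'"
    proof (rule measure_mono_fmeasurable)
      show "(\<Union>t\<in>q. {?lo t<..<?hi t}) \<subseteq> O'"
      proof safe
        fix x K y assume t: "(x, K) \<in> q" and y: "y \<in> {?lo (x, K)<..<?hi (x, K)}"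
        then have "K \<subseteq> O'" "K = {Inf K..Sup K}"
          using int[of x K] qp by (auto simp: q_def \<gamma>_def)
        with y show "y \<in> O'" by auto
      qed
    qed (use Om finq in auto)
    finally show ?thesis using Olt by simp
  qed
  have sum_bad: "(\<Sum>t\<in>q. F (?hi t) - F (?lo t)) \<le> e / 2"
  proof -
    have "(\<Sum>t\<in>q. norm (F (?hi t) - F (?lo t))) < e / 2"
    proof (rule acd[OF finq _ disj len])
      fix t assume "t \<in> q"
      then show "?lo t \<le> ?hi t \<and> {?lo t..?hi t} \<subseteq> {a..b}"
        using int[of "fst t" "snd t"] qp by (metis order_trans prod.collapse subsetD)
    qed
    moreover have "(\<Sum>t\<in>q. F (?hi t) - F (?lo t)) \<le> (\<Sum>t\<in>q. norm (F (?hi t) - F (?lo t)))"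
      by (intro sum_mono) auto
    ultimately show ?thesis by simp
  qed
  have sum_good: "(\<Sum>t\<in>p - q. F (?hi t) - F (?lo t)) \<le> c * (b - a)"
  proof -
    have "(\<Sum>t\<in>p - q. F (?hi t) - F (?lo t)) \<le> (\<Sum>t\<in>p - q. c * (?hi t - ?lo t))"
    proof (rule sum_mono)
      fix t assume t: "t \<in> p - q"
      obtain x K where tt: "t = (x, K)" by fastforce
      have xK: "(x, K) \<in> p" "x \<notin> E" using t tt by (auto simp: q_def)
      have "good x" using int[OF xK(1)] goodE xK(2) by blast
      then have "K \<subseteq> ball x (s x)" using int[OF xK(1)] xK(2) by (auto simp: \<gamma>_def)
      moreover have "Inf K \<in> K" "Sup K \<in> K"
        using int[OF xK(1)] by (metis atLeastAtMost_iff order_trans order_refl)+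
      ultimately have "\<bar>x - Inf K\<bar> < s x" "\<bar>x - Sup K\<bar> < s x"
        by (metis dist_real_def mem_ball subsetD)+
      then have "x - s x < Inf K" "Sup K < x + s x" by linarith+
      then show "F (?hi t) - F (?lo t) \<le> c * (?hi t - ?lo t)"
        using s(2)[OF \<open>good x\<close>, of "Inf K" "Sup K"] int[OF xK(1)] tt by simp
    qed
    also have "\<dots> \<le> (\<Sum>t\<in>p. c * (?hi t - ?lo t))"
      using pD(1) int \<open>c > 0\<close> by (intro sum_mono2) (force intro!: mult_nonneg_nonneg)+
    also have "\<dots> = c * (\<Sum>(x, K)\<in>p. Sup K - Inf K)"
      by (simp add: sum_distrib_left case_prod_unfold)
    also have "(\<Sum>(x, K)\<in>p. Sup K - Inf K) = b - a"
      using additive_tagged_division_1[OF \<open>a \<le> b\<close> p(1), of "\<lambda>x. x"] by simp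
    finally show ?thesis .
  qed
  have "F b - F a = (\<Sum>t\<in>p. F (?hi t) - F (?lo t))"
    using additive_tagged_division_1[OF \<open>a \<le> b\<close> p(1), of F] by (simp add: case_prod_unfold)
  also have "\<dots> = (\<Sum>t\<in>p - q. F (?hi t) - F (?lo t)) + (\<Sum>t\<in>q. F (?hi t) - F (?lo t))"
    using sum.subset_diff[OF qp pD(1)] .
  finally show "F b \<le> F a + e" using sum_bad sum_good cba by linarith
qed

text \<open>The mean value inequality: \<open>\<plusminus>F - C x\<close> is nonincreasing.\<close>

lemma absolutely_continuous_lipschitz_bound:
  fixes F :: "real \<Rightarrow> real"
  assumes "a \<le> b" and ac: "absolutely_continuous_fun_on {a..b} F"
    and der: "AE x in lebesgue. a < x \<and> x < b \<longrightarrow> (\<exists>D. \<bar>D\<bar> \<le> C \<and> (F has_real_derivative D) (at x))"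
  shows "\<bar>F b - F a\<bar> \<le> C * (b - a)"
proof -
  have key: "G b - G a \<le> C * (b - a)"
    if acG: "absolutely_continuous_fun_on {a..b} G"
      and derG: "AE x in lebesgue. a < x \<and> x < b \<longrightarrow> (\<exists>D\<le>C. (G has_real_derivative D) (at x))"
    for G :: "real \<Rightarrow> real"
  proof -
    have "absolutely_continuous_fun_on {a..b} (\<lambda>x. G x - C * x)"
      by (intro absolutely_continuous_fun_on_diff acG absolutely_continuous_fun_on_lipschitz[where L = "\<bar>C\<bar>"])
        (simp flip: right_diff_distrib add: abs_mult)
    moreover have "AE x in lebesgue. a < x \<and> x < b \<longrightarrow>
        (\<exists>D\<le>0. ((\<lambda>x. G x - C * x) has_real_derivative D) (at x))"
      using derG
    proof eventually_elim
      case (elim x)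
      show ?case
      proof
        assume "a < x \<and> x < b"
        then obtain D where "D \<le> C" "(G has_real_derivative D) (at x)" using elim by blast
        then show "\<exists>D\<le>0. ((\<lambda>x. G x - C * x) has_real_derivative D) (at x)"
          by (intro exI[of _ "D - C"]) (auto intro!: derivative_eq_intros)
      qed
    qed
    ultimately have "G b - C * b \<le> G a - C * a"
      by (rule absolutely_continuous_nonincreasing[OF \<open>a \<le> b\<close>])
    then show ?thesis by (simp add: algebra_simps)
  qed
  have "F b - F a \<le> C * (b - a)"
    using der by (intro key ac) (elim eventually_mono, meson abs_le_D1)
  moreover have "- F b - - F a \<le> C * (b - a)"
  proof (rule key)
    show "absolutely_continuous_fun_on {a..b} (\<lambda>x. - F x)"
      using absolutely_continuous_fun_on_bounded_linear[OF ac bounded_linear_minus[OF bounded_linear_ident]] .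
    show "AE x in lebesgue. a < x \<and> x < b \<longrightarrow> (\<exists>D\<le>C. ((\<lambda>x. - F x) has_real_derivative D) (at x))"
      using der
    proof eventually_elim
      case (elim x)
      show ?case
      proof
        assume "a < x \<and> x < b"
        then obtain D where "\<bar>D\<bar> \<le> C" "(F has_real_derivative D) (at x)" using elim by blast
        then show "\<exists>D\<le>C. ((\<lambda>x. - F x) has_real_derivative D) (at x)"
          by (intro exI[of _ "- D"]) (auto intro!: derivative_eq_intros)
      qed
    qed
  qed
  ultimately show ?thesis by linarith
qed

section \<open>Positive vectors for M-matrices\<close>

text \<open>Bordering a principal submatrix with the identity turns its minor into a full determinant,
  to which the library's determinant theory applies.\<close>

definition pad_minor :: "real^'m^'m \<Rightarrow> 'm set \<Rightarrow> real^'m^'m" where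
  "pad_minor A S = (\<chi> i j. if i \<in> S \<and> j \<in> S then A $ i $ j else if i = j then 1 else 0)"

lemma det_pad_minor:
  fixes A :: "real^'m^'m"
  shows "det (pad_minor A S) = principal_minor A S"
proof -
  have "det (pad_minor A S) = (\<Sum>p | p permutes UNIV. of_int (sign p) * (\<Prod>i\<in>UNIV. pad_minor A S $ i $ p i))"
    by (simp add: det_def)
  also have "\<dots> = (\<Sum>p | p permutes S. of_int (sign p) * (\<Prod>i\<in>UNIV. pad_minor A S $ i $ p i))"
  proof (rule sum.mono_neutral_right)
    show "finite {p. p permutes (UNIV::'m set)}" by simp
    show "{p. p permutes S} \<subseteq> {p. p permutes UNIV}" by (auto intro: permutes_subset)
    show "\<forall>p\<in>{p. p permutes UNIV} - {p. p permutes S}.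
        of_int (sign p) * (\<Prod>i\<in>UNIV. pad_minor A S $ i $ p i) = 0"
    proof
      fix p assume "p \<in> {p. p permutes UNIV} - {p. p permutes S}"
      then have "p permutes UNIV" "\<not> p permutes S" by auto
      then obtain i where "i \<notin> S" "p i \<noteq> i" unfolding permutes_def by auto
      then have "pad_minor A S $ i $ p i = 0" by (simp add: pad_minor_def)
      then have "(\<Prod>i\<in>UNIV. pad_minor A S $ i $ p i) = 0" by (intro prod_zero) auto
      then show "of_int (sign p) * (\<Prod>i\<in>UNIV. pad_minor A S $ i $ p i) = 0" by simp
    qed
  qed
  also have "\<dots> = principal_minor A S"
    unfolding principal_minor_def
  proof (intro sum.cong refl arg_cong2[where f = "(*)"])
    fix p assume "p \<in> {p. p permutes S}"
    then have p: "p permutes S" by simp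
    have "(\<Prod>i\<in>UNIV. pad_minor A S $ i $ p i) = (\<Prod>i\<in>S. pad_minor A S $ i $ p i)"
      using p by (intro prod.mono_neutral_right) (auto simp: pad_minor_def permutes_def)
    also have "\<dots> = (\<Prod>i\<in>S. A $ i $ p i)"
      using permutes_in_image[OF p] by (intro prod.cong) (auto simp: pad_minor_def)
    finally show "(\<Prod>i\<in>UNIV. pad_minor A S $ i $ p i) = (\<Prod>i\<in>S. A $ i $ p i)" .
  qed
  finally show ?thesis .
qed

text \<open>Adding to column \<open>k\<close> the combination \<open>y\<close> of the columns in \<open>S\<close> leaves the determinant
  unchanged and clears column \<open>k\<close> except for its diagonal entry, the Schur complement of \<open>S\<close>.  The
  column operation is an instance of Cramer's lemma, for a vector whose \<open>k\<close>th component is \<open>1\<close>.\<close>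

lemma principal_minor_insert:
  fixes A :: "real^'m^'m"
  assumes "k \<notin> S" and y: "\<And>i. i \<in> S \<Longrightarrow> (\<Sum>j\<in>S. A $ i $ j * y j) + A $ i $ k = 0"
  shows "principal_minor A (insert k S) = (A $ k $ k + (\<Sum>j\<in>S. A $ k $ j * y j)) * principal_minor A S"
proof -
  define s where "s = A $ k $ k + (\<Sum>j\<in>S. A $ k $ j * y j)"
  let ?M = "pad_minor A (insert k S)"
  define x where "x = (\<chi> i. if i = k then 1 else if i \<in> S then y i else 0)"
  have Mx: "(?M *v x) $ i = (if i = k then s else 0)" for i
  proof (cases "i \<in> insert k S")
    case True
    have "(?M *v x) $ i = (\<Sum>j\<in>UNIV. ?M $ i $ j * x $ j)" by (simp add: matrix_vector_mult_def)
    also have "\<dots> = (\<Sum>j\<in>insert k S. ?M $ i $ j * x $ j)"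
      by (intro sum.mono_neutral_right) (auto simp: x_def)
    also have "\<dots> = ?M $ i $ k * x $ k + (\<Sum>j\<in>S. ?M $ i $ j * x $ j)"
      using \<open>k \<notin> S\<close> by simp
    also have "(\<Sum>j\<in>S. ?M $ i $ j * x $ j) = (\<Sum>j\<in>S. A $ i $ j * y j)"
      using True \<open>k \<notin> S\<close> by (intro sum.cong) (auto simp: x_def pad_minor_def)
    also have "?M $ i $ k * x $ k = A $ i $ k" using True by (simp add: x_def pad_minor_def)
    finally show ?thesis using True y[of i] by (auto simp: s_def)
  next
    case False
    have "(?M *v x) $ i = (\<Sum>j\<in>UNIV. ?M $ i $ j * x $ j)" by (simp add: matrix_vector_mult_def)
    also have "\<dots> = 0"
      using False by (intro sum.neutral) (auto simp: x_def pad_minor_def)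
    finally show ?thesis using False by auto
  qed
  let ?M' = "(\<chi> i j. if j = k then (?M *v x) $ i else ?M $ i $ j) :: real^'m^'m"
  have "det ?M' = x $ k * det ?M" by (rule cramer_lemma)
  then have 1: "det ?M' = principal_minor A (insert k S)" by (simp add: x_def det_pad_minor)
  \<comment> \<open>Leibniz terms agree one by one: column k of both matrices vanishes off the diagonal.\<close>
  have "(\<Prod>i\<in>UNIV. ?M' $ i $ p i) = s * (\<Prod>i\<in>UNIV. pad_minor A S $ i $ p i)"
    if p: "p permutes UNIV" for p
  proof (cases "p k = k")
    case True
    have inj: "p i = k \<longleftrightarrow> i = k" for i using True permutes_inj[OF p] by (metis injD)
    have "(\<Prod>i\<in>UNIV. ?M' $ i $ p i) = ?M' $ k $ p k * (\<Prod>i\<in>UNIV - {k}. ?M' $ i $ p i)"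
      by (rule prod.remove) auto
    also have "?M' $ k $ p k = s * pad_minor A S $ k $ p k"
      using True Mx \<open>k \<notin> S\<close> by (simp add: pad_minor_def)
    also have "(\<Prod>i\<in>UNIV - {k}. ?M' $ i $ p i) = (\<Prod>i\<in>UNIV - {k}. pad_minor A S $ i $ p i)"
      using inj by (intro prod.cong) (auto simp: pad_minor_def)
    also have "s * pad_minor A S $ k $ p k * (\<Prod>i\<in>UNIV - {k}. pad_minor A S $ i $ p i) =
        s * (\<Prod>i\<in>UNIV. pad_minor A S $ i $ p i)"
      by (subst prod.remove[of UNIV k]) auto
    finally show ?thesis .
  next
    case False
    obtain i where i: "p i = k" using permutes_surj[OF p] by (metis surjD)
    then have "i \<noteq> k" using False by auto
    have "?M' $ i $ p i = 0" using i \<open>i \<noteq> k\<close> Mx by simp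
    then have "(\<Prod>i\<in>UNIV. ?M' $ i $ p i) = 0" by (intro prod_zero bexI[of _ i] finite UNIV_I)
    moreover have "pad_minor A S $ i $ p i = 0" using i \<open>i \<noteq> k\<close> \<open>k \<notin> S\<close> by (simp add: pad_minor_def)
    then have "(\<Prod>i\<in>UNIV. pad_minor A S $ i $ p i) = 0" by (intro prod_zero bexI[of _ i] finite UNIV_I)
    ultimately show ?thesis by (simp only: mult_zero_right)
  qed
  then have "det ?M' = (\<Sum>p | p permutes UNIV. of_int (sign p) * (s * (\<Prod>i\<in>UNIV. pad_minor A S $ i $ p i)))"
    unfolding det_def by (intro sum.cong) auto
  also have "\<dots> = s * det (pad_minor A S)"
    by (simp add: det_def sum_distrib_left ac_simps)
  finally show ?thesis using 1 by (simp add: det_pad_minor s_def)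
qed

lemma principal_minor_empty: "principal_minor A {} = 1"
  by (simp add: principal_minor_def)

text \<open>Every principal subsystem with nonnegative right-hand side has a nonnegative solution, by
  induction on the index set.  For a new index \<open>k\<close>, let \<open>y\<close> solve the old system with right-hand
  side \<open>- A $ i $ k\<close>, which is nonnegative by the sign condition, and let \<open>z\<close> solve it with right-hand
  side \<open>b\<close>.  Then \<open>z + t y\<close>, completed by \<open>t\<close> at \<open>k\<close>, satisfies all old equations, and the
  equation at \<open>k\<close> reads \<open>s t = b k - (\<Sum>j\<in>S. A $ k $ j * z j)\<close> with \<open>s\<close> the Schur complement.  Its right-hand side is
  nonnegative, and \<open>s\<close> is positive as a quotient of two principal minors.\<close>

lemma M_matrix_solve_nonneg:
  fixes A :: "real^'m^'m"
  assumes M: "M_matrix A" and b: "\<And>i. i \<in> S \<Longrightarrow> b i \<ge> 0"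
  shows "\<exists>x. (\<forall>j\<in>S. x j \<ge> 0) \<and> (\<forall>i\<in>S. (\<Sum>j\<in>S. A $ i $ j * x j) = b i)"
proof -
  have off: "A $ i $ j \<le> 0" if "i \<noteq> j" for i j using M that by (auto simp: M_matrix_def)
  have minor: "principal_minor A T > 0" for T
    using M by (cases "T = {}") (auto simp: M_matrix_def principal_minor_empty)
  have "finite S" by simp
  then show ?thesis using b
  proof (induction S arbitrary: b rule: finite_induct)
    case empty
    then show ?case by simp
  next
    case (insert k S)
    obtain y where y: "\<And>j. j \<in> S \<Longrightarrow> y j \<ge> 0" "\<And>i. i \<in> S \<Longrightarrow> (\<Sum>j\<in>S. A $ i $ j * y j) = - A $ i $ k"
      using insert.IH[of "\<lambda>i. - A $ i $ k"] off insert.hyps(2) by (metis neg_0_le_iff_le)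
    obtain z where z: "\<And>j. j \<in> S \<Longrightarrow> z j \<ge> 0" "\<And>i. i \<in> S \<Longrightarrow> (\<Sum>j\<in>S. A $ i $ j * z j) = b i"
      using insert.IH[of b] insert.prems by (metis insertCI)
    define s where "s = A $ k $ k + (\<Sum>j\<in>S. A $ k $ j * y j)"
    have "principal_minor A (insert k S) = s * principal_minor A S"
      unfolding s_def using y(2) by (intro principal_minor_insert[OF insert.hyps(2)]) simp
    then have "s > 0" using minor[of "insert k S"] minor[of S] by (metis zero_less_mult_pos2)
    define t where "t = (b k - (\<Sum>j\<in>S. A $ k $ j * z j)) / s"
    have "(\<Sum>j\<in>S. A $ k $ j * z j) \<le> 0"
    proof (rule sum_nonpos)
      fix j assume "j \<in> S"
      then have "k \<noteq> j" using insert.hyps(2) by auto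
      then show "A $ k $ j * z j \<le> 0" using off z(1)[OF \<open>j \<in> S\<close>] by (simp add: mult_nonpos_nonneg)
    qed
    then have "t \<ge> 0" using insert.prems[of k] \<open>s > 0\<close> by (simp add: t_def)
    define x where "x j = (if j = k then t else z j + t * y j)" for j
    have sumS: "(\<Sum>j\<in>S. A $ i $ j * x j) = (\<Sum>j\<in>S. A $ i $ j * z j) + t * (\<Sum>j\<in>S. A $ i $ j * y j)" for i
    proof -
      have "(\<Sum>j\<in>S. A $ i $ j * x j) = (\<Sum>j\<in>S. A $ i $ j * z j + t * (A $ i $ j * y j))"
        using insert.hyps(2) by (intro sum.cong) (auto simp: x_def algebra_simps)
      then show ?thesis by (simp add: sum.distrib sum_distrib_left)
    qed
    have "(\<Sum>j\<in>insert k S. A $ i $ j * x j) = b i" if "i \<in> insert k S" for i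
    proof -
      have "(\<Sum>j\<in>insert k S. A $ i $ j * x j) = A $ i $ k * t + (\<Sum>j\<in>S. A $ i $ j * x j)"
        using insert.hyps by (simp add: x_def)
      also have "\<dots> = b i"
      proof (cases "i = k")
        case True
        have "A $ k $ k * t + (\<Sum>j\<in>S. A $ k $ j * x j) = s * t + (\<Sum>j\<in>S. A $ k $ j * z j)"
          unfolding sumS s_def by (simp add: distrib_right distrib_left mult.commute)
        then show ?thesis using True \<open>s > 0\<close> by (simp add: t_def)
      next
        case False
        then show ?thesis using that by (simp add: sumS y z)
      qed
      finally show ?thesis .
    qed
    moreover have "x j \<ge> 0" if "j \<in> insert k S" for j
      using that \<open>t \<ge> 0\<close> y(1) z(1) by (auto simp: x_def)
    ultimately show ?case by blast
  qed
qed

text \<open>The solution for the right-hand side \<open>1\<close> cannot have a zero component: in row \<open>i\<close> the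
  off-diagonal terms are nonpositive, so the diagonal term is at least \<open>1\<close>.\<close>

lemma M_matrix_positive_vector:
  fixes A :: "real^'m^'m"
  assumes M: "M_matrix A"
  obtains \<xi> where "\<And>i. \<xi> i > 0" "\<And>i. (\<Sum>j\<in>UNIV. A $ i $ j * \<xi> j) > 0"
proof -
  obtain x where x: "\<And>j. x j \<ge> 0" "\<And>i. (\<Sum>j\<in>UNIV. A $ i $ j * x j) = 1"
    using M_matrix_solve_nonneg[OF M, of UNIV "\<lambda>_. 1"] by auto
  have "x i > 0" for i
  proof -
    have "(\<Sum>j\<in>UNIV. A $ i $ j * x j) = A $ i $ i * x i + (\<Sum>j\<in>UNIV - {i}. A $ i $ j * x j)"
      by (rule sum.remove) auto
    moreover have "(\<Sum>j\<in>UNIV - {i}. A $ i $ j * x j) \<le> 0"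
      using M x(1) by (intro sum_nonpos) (auto simp: M_matrix_def mult_nonpos_nonneg)
    ultimately have "x i \<noteq> 0" using x(2)[of i] by auto
    with x(1)[of i] show ?thesis by simp
  qed
  with x(2) that show thesis by (metis zero_less_one)
qed

section \<open>Exponential decay under delayed feedback\<close>

text \<open>At time \<open>t\<close>, component \<open>k\<close> of \<open>u\<close> obeys \<open>u\<^sub>k' = \<rho> (- d\<^sub>k u\<^sub>k(\<theta>) + F)\<close> with a rate \<open>\<rho>\<close> in
  \<open>{\<alpha>\<^sub>k..R\<^sub>k}\<close>, a leakage delay of at most \<open>\<tau>\<^sub>k\<close>, and an input \<open>F\<close> bounded by the weights \<open>w\<close> and values
  of \<open>u\<close> at most \<open>\<sigma>\<close> in the past.  Only the values of rate, delays and input at time \<open>t\<close> enter, which is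
  why they are quantified inside the definition.\<close>

definition delayed_feedback ::
  "('m::finite \<Rightarrow> real) \<Rightarrow> ('m \<Rightarrow> real) \<Rightarrow> ('m \<Rightarrow> real) \<Rightarrow> ('m \<Rightarrow> 'm \<Rightarrow> real) \<Rightarrow> ('m \<Rightarrow> real) \<Rightarrow> real \<Rightarrow>
   (real \<Rightarrow> real^'m) \<Rightarrow> 'm \<Rightarrow> real \<Rightarrow> bool" where
  "delayed_feedback d \<alpha> R w \<tau> \<sigma> u k t \<longleftrightarrow>
     (\<exists>\<rho> \<theta> F l. \<alpha> k \<le> \<rho> \<and> \<rho> \<le> R k \<and> t - \<tau> k \<le> \<theta> \<and> \<theta> \<le> t \<and>
        (\<forall>j. t - \<sigma> \<le> l j \<and> l j \<le> t) \<and> \<bar>F\<bar> \<le> (\<Sum>j\<in>UNIV. w k j * \<bar>u (l j) $ j\<bar>) \<and>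
        ((\<lambda>s. u s $ k) has_real_derivative \<rho> * (- d k * u \<theta> $ k + F)) (at t))"

text \<open>A first exit argument.  Let \<open>E t = exp (- \<mu> (t - t\<^sub>0))\<close> and let \<open>T\<close> be the first time at which
  some \<open>\<bar>u\<^sub>k\<bar>\<close> reaches its barrier \<open>B \<xi>\<^sub>k E\<close>.  Before \<open>T\<close> every component lies below its barrier, at the
  cost of a factor \<open>e = exp (\<mu> \<sigma>)\<close> for values delayed by up to \<open>\<sigma>\<close>.  This bounds the input and the
  speed of \<open>u\<^sub>k\<close>, hence also the difference \<open>u\<^sub>k(t) - u\<^sub>k(\<theta>)\<close>, up to an extra \<open>2 K\<close> when \<open>\<theta>\<close> lies in the
  initial interval, where \<open>u\<close> need not be differentiable.  Replacing \<open>u\<^sub>k(\<theta>)\<close> by \<open>u\<^sub>k(t)\<close>, the hypothesis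
  \<open>margin\<close> says exactly that the instantaneous damping \<open>d\<^sub>k u\<^sub>k(t)\<close> near the barrier beats all error
  terms and the decay rate of the barrier itself.  So \<open>\<bar>u\<^sub>k\<bar> - B \<xi>\<^sub>k E\<close> has nonpositive derivative almost
  everywhere just before \<open>T\<close>, and cannot climb from a negative value to zero at \<open>T\<close>.\<close>

lemma delayed_feedback_weighted_bound:
  fixes u :: "real \<Rightarrow> real^'m" and \<xi> :: "'m \<Rightarrow> real"
  assumes d: "\<And>k. d k > 0" and \<alpha>: "\<And>k. \<alpha> k > 0" and \<alpha>R: "\<And>k. \<alpha> k \<le> R k" and w: "\<And>k j. w k j \<ge> 0"
    and \<tau>: "\<And>k. 0 \<le> \<tau> k" "\<And>k. \<tau> k \<le> \<sigma>" and \<xi>: "\<And>k. \<xi> k > 0" and lam: "\<mu> \<ge> 0"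
    and ac: "\<And>T. T \<ge> t0 \<Longrightarrow> absolutely_continuous_fun_on {t0..T} u"
    and fb: "AE t in lebesgue. t > t0 \<longrightarrow> (\<forall>k. delayed_feedback d \<alpha> R w \<tau> \<sigma> u k t)"
    and hist: "\<And>s k. t0 - \<sigma> \<le> s \<Longrightarrow> s \<le> t0 \<Longrightarrow> \<bar>u s $ k\<bar> \<le> K"
    and start: "\<And>k. K < B * \<xi> k"
    and margin: "\<And>k. 2 * d k * K * exp (\<mu> * \<sigma>)
        + B * (d k * R k * \<tau> k * (d k * \<xi> k + (\<Sum>j\<in>UNIV. w k j * \<xi> j)) * (exp (\<mu> * \<sigma>))\<^sup>2
          + (\<Sum>j\<in>UNIV. w k j * \<xi> j) * exp (\<mu> * \<sigma>) + \<mu> / \<alpha> k * \<xi> k) < B * (d k * \<xi> k)"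
    and t1: "t0 \<le> t1"
  shows "\<bar>u t1 $ k\<bar> < B * \<xi> k * exp (- \<mu> * (t1 - t0))"
proof -
  define E where "E t = exp (- \<mu> * (t - t0))" for t
  define e where "e = exp (\<mu> * \<sigma>)"
  define q where "q k = (\<Sum>j\<in>UNIV. w k j * \<xi> j)" for k
  define V where "V k = R k * (d k * \<xi> k + q k) * B * e" for k
  have "\<sigma> \<ge> 0" using \<tau> order_trans by blast
  have R: "R k > 0" for k using \<alpha> \<alpha>R less_le_trans by blast
  have "K \<ge> 0" using hist[of t0] \<open>\<sigma> \<ge> 0\<close> by (meson abs_ge_zero diff_left_mono diff_0_right le_add_same_cancel1 order_refl order_trans diff_le_eq)
  have "B > 0" using start[of undefined] \<open>K \<ge> 0\<close> \<xi>[of undefined] by (metis le_less_trans zero_less_mult_pos2)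
  have Epos: "E t > 0" for t by (simp add: E_def)
  have "e \<ge> 1" using lam \<open>\<sigma> \<ge> 0\<close> by (simp add: e_def)
  have E0: "E t0 = 1" by (simp add: E_def)
  have Eback: "E s \<le> e * E t" if "t - \<sigma> \<le> s" for s t
  proof -
    have "\<mu> * t \<le> \<mu> * (s + \<sigma>)" using lam that by (intro mult_left_mono) auto
    then show ?thesis by (simp add: E_def e_def flip: exp_add) (simp add: algebra_simps)
  qed
  have q0: "q k \<ge> 0" for k unfolding q_def using w \<xi> by (intro sum_nonneg) (simp add: less_imp_le)
  have V0: "V k \<ge> 0" for k
    unfolding V_def using R[of k] d[of k] \<xi>[of k] q0[of k] \<open>B > 0\<close> \<open>e \<ge> 1\<close>
    by (intro mult_nonneg_nonneg add_nonneg_nonneg) auto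
  have cont: "continuous_on {t0..T} (\<lambda>t. u t $ k)" if "T \<ge> t0" for T k
    using absolutely_continuous_fun_on_imp_continuous_on[OF ac[OF that]]
    by (intro continuous_intros) auto
  have contE: "continuous_on S E" for S
    unfolding E_def by (intro continuous_intros)
  have "\<bar>u t1 $ k\<bar> < B * \<xi> k * E t1" for k
  proof (rule ccontr)
    assume contra: "\<not> \<bar>u t1 $ k\<bar> < B * \<xi> k * E t1"
    define S where "S = (\<Union>k. {t \<in> {t0..t1}. B * \<xi> k * E t \<le> \<bar>u t $ k\<bar>})"
    have "closed S" unfolding S_def
      by (intro closed_UN ballI continuous_on_closed_Collect_le continuous_intros contE cont[OF t1]) auto
    have "t1 \<in> S" using contra t1 by (auto simp: S_def not_less)
    have bdd: "bdd_below S" by (intro bdd_belowI[of _ t0]) (auto simp: S_def)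
    define T where "T = Inf S"
    have "T \<in> S" unfolding T_def using \<open>t1 \<in> S\<close> bdd \<open>closed S\<close> by (intro closed_contains_Inf) auto
    then obtain k where k: "B * \<xi> k * E T \<le> \<bar>u T $ k\<bar>" and T: "t0 \<le> T" "T \<le> t1" by (auto simp: S_def)
    have "T \<noteq> t0" using k start[of k] hist[of t0 k] \<open>\<sigma> \<ge> 0\<close> E0 by auto
    then have "t0 < T" using T by simp
    have below: "\<bar>u s $ j\<bar> < B * \<xi> j * E s" if s: "t0 - \<sigma> \<le> s" "s < T" for s j
    proof (cases "s \<le> t0")
      case True
      then have "E s \<ge> 1" using lam by (simp add: E_def mult_nonneg_nonpos)
      then have "B * \<xi> j * 1 \<le> B * \<xi> j * E s"
        using \<open>B > 0\<close> \<xi>[of j] by (intro mult_left_mono) auto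
      then show ?thesis using hist[OF s(1) True, of j] start[of j] by linarith
    next
      case False
      have "s \<notin> S" using s(2) bdd unfolding T_def by (metis cInf_lower not_le)
      then show ?thesis using False s(2) T by (force simp: S_def not_le)
    qed
    have delayed: "\<bar>u s $ j\<bar> \<le> B * \<xi> j * e * E t" if "t0 < t" "t < T" "t - \<sigma> \<le> s" "s \<le> t" for s t j
    proof -
      have "\<bar>u s $ j\<bar> \<le> B * \<xi> j * E s" using below[of s j] that by simp
      also have "\<dots> \<le> B * \<xi> j * (e * E t)"
        using Eback[OF that(3)] \<open>B > 0\<close> \<xi>[of j] by (intro mult_left_mono) auto
      finally show ?thesis by (simp add: mult.assoc)
    qed
    have input: "\<bar>F\<bar> \<le> q k * B * e * E t"
      if "t0 < t" "t < T" "\<forall>j. t - \<sigma> \<le> l j \<and> l j \<le> t" "\<bar>F\<bar> \<le> (\<Sum>j\<in>UNIV. w k j * \<bar>u (l j) $ j\<bar>)"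
      for t F k l
    proof -
      have "(\<Sum>j\<in>UNIV. w k j * \<bar>u (l j) $ j\<bar>) \<le> (\<Sum>j\<in>UNIV. w k j * (B * \<xi> j * e * E t))"
        using that(1-3) w by (intro sum_mono mult_left_mono delayed) auto
      also have "\<dots> = q k * B * e * E t"
        by (simp add: q_def sum_distrib_left sum_distrib_right ac_simps)
      finally show ?thesis using that(4) by simp
    qed
    have speed: "\<exists>D. \<bar>D\<bar> \<le> V k * E t \<and> ((\<lambda>s. u s $ k) has_real_derivative D) (at t)"
      if t: "t0 < t" "t < T" and fbt: "delayed_feedback d \<alpha> R w \<tau> \<sigma> u k t" for t k
    proof -
      obtain \<rho> \<theta> F l where *: "\<alpha> k \<le> \<rho>" "\<rho> \<le> R k" "t - \<tau> k \<le> \<theta>" "\<theta> \<le> t"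
        "\<forall>j. t - \<sigma> \<le> l j \<and> l j \<le> t" "\<bar>F\<bar> \<le> (\<Sum>j\<in>UNIV. w k j * \<bar>u (l j) $ j\<bar>)"
        "((\<lambda>s. u s $ k) has_real_derivative \<rho> * (- d k * u \<theta> $ k + F)) (at t)"
        using fbt unfolding delayed_feedback_def by blast
      have "\<bar>u \<theta> $ k\<bar> \<le> B * \<xi> k * e * E t"
        using t *(3,4) \<tau>(2)[of k] by (intro delayed) auto
      then have "d k * \<bar>u \<theta> $ k\<bar> \<le> d k * (B * \<xi> k * e * E t)"
        using d[of k] by (intro mult_left_mono) auto
      moreover have "\<bar>F\<bar> \<le> q k * B * e * E t" by (rule input[OF t *(5,6)])
      moreover have "\<bar>- d k * u \<theta> $ k + F\<bar> \<le> d k * \<bar>u \<theta> $ k\<bar> + \<bar>F\<bar>"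
        using abs_triangle_ineq[of "- d k * u \<theta> $ k" F] d[of k] by (simp add: abs_mult)
      ultimately have "\<bar>- d k * u \<theta> $ k + F\<bar> \<le> d k * (B * \<xi> k * e * E t) + q k * B * e * E t"
        by linarith
      then have "\<rho> * \<bar>- d k * u \<theta> $ k + F\<bar> \<le> R k * (d k * (B * \<xi> k * e * E t) + q k * B * e * E t)"
        using *(2) R[of k] by (intro mult_mono) auto
      also have "\<dots> = V k * E t" by (simp add: V_def algebra_simps)
      finally have "\<bar>\<rho> * (- d k * u \<theta> $ k + F)\<bar> \<le> V k * E t"
        using *(1) \<alpha>[of k] by (simp add: abs_mult)
      with *(7) show ?thesis by blast
    qed
    \<comment> \<open>The mean value inequality on an interval inside the domain of the equation.\<close>
    have short_move: "\<bar>u y $ k - u x $ k\<bar> \<le> V k * (e * E y) * (y - x)"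
      if xy: "t0 \<le> x" "x \<le> y" "y < T" "y - x \<le> \<sigma>" for x y k
    proof (rule absolutely_continuous_lipschitz_bound[OF xy(2)])
      have "absolutely_continuous_fun_on {t0..y} (\<lambda>t. u t $ k)"
        by (intro absolutely_continuous_fun_on_bounded_linear[OF ac] bounded_linear_vec_nth) (use xy in auto)
      then show "absolutely_continuous_fun_on {x..y} (\<lambda>t. u t $ k)"
        by (rule absolutely_continuous_fun_on_subset) (use xy in auto)
      show "AE s in lebesgue. x < s \<and> s < y \<longrightarrow>
          (\<exists>D. \<bar>D\<bar> \<le> V k * (e * E y) \<and> ((\<lambda>t. u t $ k) has_real_derivative D) (at s))"
        using fb
      proof eventually_elim
        case (elim s)
        show ?case
        proof
          assume s: "x < s \<and> s < y"
          then obtain D where D: "\<bar>D\<bar> \<le> V k * E s" "((\<lambda>t. u t $ k) has_real_derivative D) (at s)"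
            using speed[of s k] elim xy by auto
          have "V k * E s \<le> V k * (e * E y)"
            using V0[of k] s xy by (intro mult_left_mono Eback) auto
          with D show "\<exists>D. \<bar>D\<bar> \<le> V k * (e * E y) \<and> ((\<lambda>t. u t $ k) has_real_derivative D) (at s)"
            by (meson order_trans)
        qed
      qed
    qed
    \<comment> \<open>If the delayed time precedes t0, split at t0; there e * E t is at least 1 because t - t0 is at most the delay.\<close>
    have move: "\<bar>u t $ k - u \<theta> $ k\<bar> \<le> (\<tau> k * V k + 2 * K) * (e * E t)"
      if t: "t0 < t" "t < T" "t - \<tau> k \<le> \<theta>" "\<theta> \<le> t" for t \<theta> k
    proof -
      define x where "x = max t0 \<theta>"
      have x: "t0 \<le> x" "x \<le> t" "t - x \<le> \<tau> k" using t by (auto simp: x_def)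
      have "\<bar>u t $ k - u x $ k\<bar> \<le> V k * (e * E t) * (t - x)"
        using x t \<tau>(2)[of k] by (intro short_move) auto
      also have "\<dots> \<le> V k * (e * E t) * \<tau> k"
        using x V0[of k] Epos[of t] \<open>e \<ge> 1\<close> by (intro mult_left_mono mult_nonneg_nonneg) auto
      finally have 1: "\<bar>u t $ k - u x $ k\<bar> \<le> V k * (e * E t) * \<tau> k" .
      have 2: "\<bar>u x $ k - u \<theta> $ k\<bar> \<le> 2 * K * (e * E t)"
      proof (cases "\<theta> \<le> t0")
        case True
        have "1 \<le> e * E t" using Eback[of t t0] E0 t True \<tau>(2)[of k] by simp
        then have "2 * K * 1 \<le> 2 * K * (e * E t)" using \<open>K \<ge> 0\<close> by (intro mult_left_mono) auto
        moreover have "\<bar>u t0 $ k\<bar> \<le> K" "\<bar>u \<theta> $ k\<bar> \<le> K"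
          using hist[of t0 k] hist[of \<theta> k] t True \<tau>(2)[of k] \<open>\<sigma> \<ge> 0\<close> by auto
        ultimately show ?thesis using True by (auto simp: x_def max_def)
      next
        case False
        then show ?thesis using \<open>K \<ge> 0\<close> Epos[of t] \<open>e \<ge> 1\<close> by (simp add: x_def max_def)
      qed
      show ?thesis using 1 2 by (simp add: algebra_simps)
    qed
    \<comment> \<open>The sign reduces a crossing of the lower barrier to a crossing of the upper one.\<close>
    define sg where "sg = (if u T $ k \<ge> 0 then 1 else - 1 :: real)"
    have sg: "sg * u T $ k = \<bar>u T $ k\<bar>" "\<bar>sg\<bar> = 1" by (auto simp: sg_def)
    have sgle: "sg * x \<le> \<bar>x\<bar>" for x using sg(2) by (auto simp: sg_def)
    \<comment> \<open>The slack in the margin; a damping term short of its barrier value by less than m is still sufficient.\<close>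
    define m where "m = B * (d k * \<xi> k) - (2 * d k * K * e + B * (d k * R k * \<tau> k * (d k * \<xi> k + q k) * e\<^sup>2
        + q k * e + \<mu> / \<alpha> k * \<xi> k))"
    have "m > 0" using margin[of k] by (simp add: m_def e_def q_def)
    \<comment> \<open>Positivity of this function near T means that u is within m / d k * E t of the barrier.\<close>
    define \<phi> where "\<phi> t = sg * u t $ k - (B * \<xi> k - m / d k) * E t" for t
    have "m / d k * E T > 0" using \<open>m > 0\<close> d[of k] Epos[of T] by simp
    then have "\<phi> T > 0" using k sg(1) by (simp add: \<phi>_def algebra_simps)
    have "continuous_on {t0..T} \<phi>" unfolding \<phi>_def by (intro continuous_intros contE cont[OF T(1)])
    then obtain \<delta> where \<delta>: "\<delta> > 0" "\<And>t. t \<in> {t0..T} \<Longrightarrow> dist t T < \<delta> \<Longrightarrow> dist (\<phi> t) (\<phi> T) < \<phi> T"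
      using \<open>\<phi> T > 0\<close> T(1) unfolding continuous_on_iff by (metis atLeastAtMost_iff order_refl)
    define a where "a = max t0 (T - \<delta> / 2)"
    have a: "t0 \<le> a" "a < T" using \<open>t0 < T\<close> \<delta>(1) by (auto simp: a_def)
    have near: "(B * \<xi> k - m / d k) * E t < sg * u t $ k" if "a < t" "t < T" for t
    proof -
      have "dist (\<phi> t) (\<phi> T) < \<phi> T" using that \<delta>(1) by (intro \<delta>(2)) (auto simp: a_def dist_real_def)
      then have "\<phi> t > 0" by (auto simp: dist_real_def)
      then show ?thesis by (simp add: \<phi>_def)
    qed
    define Q where "Q t = sg * u t $ k - B * \<xi> k * E t" for t
    have "Q T \<le> Q a"
    proof (rule absolutely_continuous_nonincreasing[where F = Q])
      show "a \<le> T" using a by simp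
      have "absolutely_continuous_fun_on {t0..T} (\<lambda>t. sg * u t $ k)"
        by (rule absolutely_continuous_fun_on_bounded_linear[OF ac[OF T(1)],
              of "\<lambda>v. sg * v $ k"])
          (rule bounded_linear_const_mult[OF bounded_linear_vec_nth])
      moreover have "absolutely_continuous_fun_on {t0..T} (\<lambda>t. B * \<xi> k * E t)"
      proof (rule absolutely_continuous_fun_on_lipschitz)
        fix x y assume xy: "x \<in> {t0..T}" "y \<in> {t0..T}"
        show "norm (B * \<xi> k * E x - B * \<xi> k * E y) \<le> (B * \<xi> k * \<mu>) * \<bar>x - y\<bar>"
        proof -
          have "norm (B * \<xi> k * E x - B * \<xi> k * E y) \<le> (B * \<xi> k * \<mu>) * norm (x - y)"
          proof (rule field_differentiable_bound)
            show "convex {t0..T}" by simp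
            fix z assume z: "z \<in> {t0..T}"
            show "((\<lambda>t. B * \<xi> k * E t) has_field_derivative - (B * \<xi> k * \<mu> * E z)) (at z within {t0..T})"
              unfolding E_def by (auto intro!: derivative_eq_intros)
            have "E z \<le> 1" using z lam by (simp add: E_def)
            then have "B * \<xi> k * \<mu> * E z \<le> B * \<xi> k * \<mu> * 1"
              using \<open>B > 0\<close> \<xi>[of k] lam by (intro mult_left_mono) auto
            moreover have "B * \<xi> k * \<mu> * E z \<ge> 0"
              using \<open>B > 0\<close> \<xi>[of k] lam Epos[of z] by (intro mult_nonneg_nonneg) auto
            ultimately show "norm (- (B * \<xi> k * \<mu> * E z)) \<le> B * \<xi> k * \<mu>" by simp
          qed (use xy in auto)
          then show ?thesis by simp
        qed
      qed
      ultimately have "absolutely_continuous_fun_on {t0..T} Q"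
        unfolding Q_def by (rule absolutely_continuous_fun_on_diff)
      then show "absolutely_continuous_fun_on {a..T} Q"
        by (rule absolutely_continuous_fun_on_subset) (use a in auto)
      show "AE t in lebesgue. a < t \<and> t < T \<longrightarrow> (\<exists>D\<le>0. (Q has_real_derivative D) (at t))"
        using fb
      proof eventually_elim
        case (elim t)
        show ?case
        proof
          assume "a < t \<and> t < T"
          then have t: "a < t" "t < T" "t0 < t" using a by auto
          obtain \<rho> \<theta> F l where *: "\<alpha> k \<le> \<rho>" "\<rho> \<le> R k" "t - \<tau> k \<le> \<theta>" "\<theta> \<le> t"
            "\<forall>j. t - \<sigma> \<le> l j \<and> l j \<le> t" "\<bar>F\<bar> \<le> (\<Sum>j\<in>UNIV. w k j * \<bar>u (l j) $ j\<bar>)"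
            and der: "((\<lambda>s. u s $ k) has_real_derivative \<rho> * (- d k * u \<theta> $ k + F)) (at t)"
            using elim t(3) unfolding delayed_feedback_def by blast
          have "\<bar>F\<bar> \<le> q k * B * e * E t" by (rule input[OF t(3,2) *(5,6)])
          then have F: "sg * F \<le> q k * B * e * E t" using sgle[of F] by simp
          have "sg * (u t $ k - u \<theta> $ k) \<le> (\<tau> k * V k + 2 * K) * (e * E t)"
            using move[OF t(3,2) *(3,4)] sgle order_trans by blast
          then have "- (sg * u \<theta> $ k) \<le> (\<tau> k * V k + 2 * K) * (e * E t) - (B * \<xi> k - m / d k) * E t"
            using near[OF t(1,2)] by (simp add: algebra_simps)
          then have "d k * - (sg * u \<theta> $ k) \<le>
              d k * ((\<tau> k * V k + 2 * K) * (e * E t) - (B * \<xi> k - m / d k) * E t)"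
            using d[of k] by (intro mult_left_mono) auto
          also have "\<dots> = (d k * (\<tau> k * V k + 2 * K) * e - B * (d k * \<xi> k) + m) * E t"
            using d[of k] by (simp add: algebra_simps)
          finally have "d k * - (sg * u \<theta> $ k) + sg * F \<le>
              (d k * (\<tau> k * V k + 2 * K) * e - B * (d k * \<xi> k) + m) * E t + q k * B * e * E t"
            using F by linarith
          also have "\<dots> = (d k * (\<tau> k * V k + 2 * K) * e - B * (d k * \<xi> k) + m + q k * B * e) * E t"
            by (simp add: algebra_simps)
          also have "d k * (\<tau> k * V k + 2 * K) * e - B * (d k * \<xi> k) + m + q k * B * e = - (B * (\<mu> / \<alpha> k * \<xi> k))"
            by (simp add: m_def V_def algebra_simps power2_eq_square)
          finally have "\<rho> * (d k * - (sg * u \<theta> $ k) + sg * F) \<le> \<rho> * (- (B * (\<mu> / \<alpha> k * \<xi> k)) * E t)"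
            using *(1) \<alpha>[of k] by (intro mult_left_mono) auto
          also have "\<dots> \<le> - (B * \<xi> k * \<mu> * E t)"
          proof -
            have "\<alpha> k * (B * (\<mu> / \<alpha> k * \<xi> k) * E t) \<le> \<rho> * (B * (\<mu> / \<alpha> k * \<xi> k) * E t)"
              using *(1) \<alpha>[of k] \<open>B > 0\<close> lam \<xi>[of k] Epos[of t]
              by (intro mult_right_mono mult_nonneg_nonneg divide_nonneg_nonneg) auto
            then show ?thesis using \<alpha>[of k] by (simp add: field_simps)
          qed
          finally have "sg * (\<rho> * (- d k * u \<theta> $ k + F)) + B * \<xi> k * \<mu> * E t \<le> 0"
            by (simp add: algebra_simps)
          moreover have "(Q has_real_derivative (sg * (\<rho> * (- d k * u \<theta> $ k + F)) + B * \<xi> k * \<mu> * E t)) (at t)"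
            unfolding Q_def E_def by (auto intro!: derivative_eq_intros der)
          ultimately show "\<exists>D\<le>0. (Q has_real_derivative D) (at t)" by blast
        qed
      qed
    qed
    moreover have "Q a < 0"
      using below[of a k] sgle[of "u a $ k"] a \<open>\<sigma> \<ge> 0\<close> by (simp add: Q_def)
    moreover have "Q T \<ge> 0" using k sg(1) by (simp add: Q_def)
    ultimately show False by simp
  qed
  then show ?thesis by (simp add: E_def)
qed

text \<open>The hypothesis \<open>dominance\<close> is the margin condition without initial data at rate \<open>\<mu> = 0\<close>.  It
  is strict, so by continuity it survives for some \<open>\<mu> > 0\<close>; the barrier height \<open>B\<close> is then taken as
  a large multiple of the initial bound.  The constants depend neither on \<open>t0\<close> nor on \<open>u\<close>.\<close>

lemma delayed_feedback_exponential_decay: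
  fixes \<xi> :: "'m::finite \<Rightarrow> real"
  assumes d: "\<And>k. d k > 0" and \<alpha>: "\<And>k. \<alpha> k > 0" and \<alpha>R: "\<And>k. \<alpha> k \<le> R k" and w: "\<And>k j. w k j \<ge> 0"
    and \<tau>: "\<And>k. 0 \<le> \<tau> k" "\<And>k. \<tau> k \<le> \<sigma>" and \<xi>: "\<And>k. \<xi> k > 0"
    and dominance: "\<And>k. d k * R k * \<tau> k * (d k * \<xi> k + (\<Sum>j\<in>UNIV. w k j * \<xi> j))
        + (\<Sum>j\<in>UNIV. w k j * \<xi> j) < d k * \<xi> k"
  obtains M \<mu> where "M > 0" "\<mu> > 0"
    "\<And>t0 u K t k. \<lbrakk>\<And>T. T \<ge> t0 \<Longrightarrow> absolutely_continuous_fun_on {t0..T} u;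
       AE t in lebesgue. t > t0 \<longrightarrow> (\<forall>k. delayed_feedback d \<alpha> R w \<tau> \<sigma> u k t);
       \<And>s k. t0 - \<sigma> \<le> s \<Longrightarrow> s \<le> t0 \<Longrightarrow> \<bar>u s $ k\<bar> \<le> K; t0 \<le> t\<rbrakk>
       \<Longrightarrow> \<bar>u t $ k\<bar> \<le> M * K * exp (- \<mu> * (t - t0))"
proof -
  define q where "q k = (\<Sum>j\<in>UNIV. w k j * \<xi> j)" for k
  define load where "load \<mu> k = d k * R k * \<tau> k * (d k * \<xi> k + q k) * (exp (\<mu> * \<sigma>))\<^sup>2
      + q k * exp (\<mu> * \<sigma>) + \<mu> / \<alpha> k * \<xi> k" for \<mu> k
  have "\<forall>\<^sub>F \<mu> in at_right 0. load \<mu> k < d k * \<xi> k" for k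
  proof -
    have "((\<lambda>\<mu>. load \<mu> k) \<longlongrightarrow> load 0 k) (at_right 0)"
      unfolding load_def using \<alpha>[of k] by (intro tendsto_intros) auto
    moreover have "load 0 k < d k * \<xi> k" using dominance[of k] by (simp add: load_def q_def)
    ultimately show ?thesis by (rule order_tendstoD)
  qed
  then have "\<forall>\<^sub>F \<mu> in at_right 0. \<forall>k. load \<mu> k < d k * \<xi> k" by (rule eventually_all_finite)
  moreover have "\<forall>\<^sub>F \<mu> in at_right (0::real). \<mu> > 0" by (rule eventually_at_right_less)
  ultimately have "\<forall>\<^sub>F \<mu> in at_right 0. \<mu> > 0 \<and> (\<forall>k. load \<mu> k < d k * \<xi> k)"
    by eventually_elim simp
  then obtain \<mu> where "\<mu> > 0" and load: "\<And>k. load \<mu> k < d k * \<xi> k"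
    using eventually_happens' trivial_limit_at_right_real by blast
  \<comment> \<open>M exceeds both lower bounds: 1 / xi for the start, c for the margin.\<close>
  define c where "c k = 2 * d k * exp (\<mu> * \<sigma>) / (d k * \<xi> k - load \<mu> k)" for k
  define M where "M = 1 + (\<Sum>k\<in>UNIV. 1 / \<xi> k + c k)"
  have c: "c k > 0" for k using d[of k] load[of k] by (simp add: c_def)
  have bound: "1 / \<xi> k + c k < M" for k
  proof -
    have "1 / \<xi> k + c k \<le> (\<Sum>k\<in>UNIV. 1 / \<xi> k + c k)"
      using c \<xi> by (intro member_le_sum) (auto simp: less_imp_le add_nonneg_nonneg)
    then show ?thesis by (simp add: M_def)
  qed
  have "M > 0" using bound[of undefined] c[of undefined] \<xi>[of undefined]
    by (meson add_pos_pos less_trans zero_less_divide_1_iff)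
  have M1: "1 < M * \<xi> k" for k
  proof -
    have "1 / \<xi> k < M" using bound[of k] c[of k] by linarith
    then show ?thesis using \<xi>[of k] by (simp add: field_simps)
  qed
  have M2: "2 * d k * exp (\<mu> * \<sigma>) + M * load \<mu> k < M * (d k * \<xi> k)" for k
  proof -
    have "0 < 1 / \<xi> k" using \<xi>[of k] by simp
    then have "c k < M" using bound[of k] by linarith
    then show ?thesis using load[of k] by (simp add: c_def field_simps)
  qed
  define C where "C = M * (\<Sum>k\<in>UNIV. \<xi> k)"
  have "C > 0" unfolding C_def using \<open>M > 0\<close> \<xi> by (intro mult_pos_pos sum_pos) auto
  show thesis
  proof (rule that[OF \<open>C > 0\<close> \<open>\<mu> > 0\<close>])
    fix t0 :: real and u :: "real \<Rightarrow> real^'m" and K t k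
    assume ac: "\<And>T. T \<ge> t0 \<Longrightarrow> absolutely_continuous_fun_on {t0..T} u"
      and fb: "AE t in lebesgue. t > t0 \<longrightarrow> (\<forall>k. delayed_feedback d \<alpha> R w \<tau> \<sigma> u k t)"
      and hist: "\<And>s k. t0 - \<sigma> \<le> s \<Longrightarrow> s \<le> t0 \<Longrightarrow> \<bar>u s $ k\<bar> \<le> K" and t: "t0 \<le> t"
    have "\<sigma> \<ge> 0" using \<tau> order_trans by blast
    then have "K \<ge> 0" using hist[of t0 k] by (auto intro: order_trans[OF abs_ge_zero])
    let ?E = "exp (- \<mu> * (t - t0))"
    \<comment> \<open>The barrier argument needs a positive initial bound, so it is applied to every larger one.\<close>
    have strict: "\<bar>u t $ k\<bar> \<le> C * K' * ?E" if "K < K'" for K'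
    proof -
      have "K' > 0" using that \<open>K \<ge> 0\<close> by simp
      have "\<bar>u t $ k\<bar> < (M * K') * \<xi> k * ?E"
      proof (rule delayed_feedback_weighted_bound[OF d \<alpha> \<alpha>R w \<tau> \<xi> _ ac fb _ _ _ t])
        show "\<mu> \<ge> 0" using \<open>\<mu> > 0\<close> by simp
        show "\<bar>u s $ k\<bar> \<le> K'" if "t0 - \<sigma> \<le> s" "s \<le> t0" for s k
          using hist[OF that, of k] \<open>K < K'\<close> by simp
        show "K' < M * K' * \<xi> k" for k
          using mult_strict_left_mono[OF M1[of k] \<open>K' > 0\<close>] by (simp add: ac_simps)
        show "2 * d k * K' * exp (\<mu> * \<sigma>) + M * K' *
            (d k * R k * \<tau> k * (d k * \<xi> k + (\<Sum>j\<in>UNIV. w k j * \<xi> j)) * (exp (\<mu> * \<sigma>))\<^sup>2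
            + (\<Sum>j\<in>UNIV. w k j * \<xi> j) * exp (\<mu> * \<sigma>) + \<mu> / \<alpha> k * \<xi> k) < M * K' * (d k * \<xi> k)" for k
          using mult_strict_left_mono[OF M2[of k] \<open>K' > 0\<close>]
          unfolding load_def q_def by (simp only: distrib_left ac_simps)
      qed
      also have "M * K' * \<xi> k * ?E \<le> M * K' * (\<Sum>k\<in>UNIV. \<xi> k) * ?E"
        using \<open>M > 0\<close> \<open>K' > 0\<close> \<xi>
        by (intro mult_right_mono mult_left_mono member_le_sum) (auto simp: less_imp_le)
      finally show ?thesis by (simp add: C_def ac_simps)
    qed
    show "\<bar>u t $ k\<bar> \<le> C * K * ?E"
    proof (rule field_le_epsilon)
      fix \<epsilon> :: real assume "\<epsilon> > 0"
      then have "\<bar>u t $ k\<bar> \<le> C * (K + \<epsilon> / (C * ?E)) * ?E"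
        using \<open>C > 0\<close> by (intro strict) simp
      also have "\<dots> = C * K * ?E + \<epsilon>" using \<open>C > 0\<close> by (simp add: field_simps)
      finally show "\<bar>u t $ k\<bar> \<le> C * K * ?E + \<epsilon>" .
    qed
  qed
qed

section \<open>Stability of the BAM network\<close>

text \<open>Equivalence of norms in finite dimension, in the two directions that pass between \<open>N\<close> and
  componentwise bounds.  The lower bound comes from the minimum of \<open>N\<close> on the unit sphere.\<close>

lemma is_norm_equivalent_to_components:
  fixes N :: "real^'m \<Rightarrow> real"
  assumes "is_norm N"
  obtains c C where "c > 0" "C > 0" "\<And>x k. \<bar>x $ k\<bar> \<le> c * N x"
    "\<And>x B. (\<And>k. \<bar>x $ k\<bar> \<le> B) \<Longrightarrow> N x \<le> C * B"
proof -
  have N0: "N x \<ge> 0" and N_eq0: "N x = 0 \<longleftrightarrow> x = 0" and N_scale: "N (a *\<^sub>R x) = \<bar>a\<bar> * N x"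
    and N_add: "N (x + y) \<le> N x + N y" for x y a
    using assms by (auto simp: is_norm_def)
  define C where "C = 1 + (\<Sum>k\<in>UNIV. N (axis k 1))"
  have "C > 0" unfolding C_def using N0 by (intro add_pos_nonneg sum_nonneg) auto
  have "N 0 = 0" using N_eq0 by blast
  have N_sum: "N (sum h S) \<le> (\<Sum>k\<in>S. N (h k))" if "finite S" for h :: "'m \<Rightarrow> real^'m" and S
    using that by induction (auto simp: \<open>N 0 = 0\<close> intro: order_trans[OF N_add])
  have upper: "N x \<le> C * B" if B: "\<And>k. \<bar>x $ k\<bar> \<le> B" for x B
  proof -
    have "B \<ge> 0" using B[of undefined] by (meson abs_ge_zero order_trans)
    have "x = (\<Sum>k\<in>UNIV. (x $ k) *\<^sub>R axis k 1)"
      using basis_expansion[of x] by (simp add: scalar_mult_eq_scaleR)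
    then have "N x \<le> (\<Sum>k\<in>UNIV. N ((x $ k) *\<^sub>R axis k 1))" using N_sum by (metis finite)
    also have "\<dots> \<le> (\<Sum>k\<in>UNIV. B * N (axis k 1))"
      unfolding N_scale using B N0 by (intro sum_mono mult_right_mono)
    also have "\<dots> \<le> C * B" using \<open>B \<ge> 0\<close> by (simp add: C_def algebra_simps flip: sum_distrib_left)
    finally show ?thesis .
  qed
  have upper_norm: "N x \<le> C * norm x" for x
    by (rule upper) (simp add: component_le_norm_cart)
  have "C-lipschitz_on UNIV N"
  proof (rule lipschitz_onI)
    show "dist (N x) (N y) \<le> C * dist x y" for x y
      using N_add[of "x - y" y] N_add[of "y - x" x] upper_norm[of "x - y"] upper_norm[of "y - x"]
      by (simp add: dist_norm norm_minus_commute abs_le_iff)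
  qed (use \<open>C > 0\<close> in simp)
  then have "continuous_on (sphere 0 1) N"
    by (meson continuous_on_subset lipschitz_on_continuous_on subset_UNIV)
  moreover have "sphere (0::real^'m) 1 \<noteq> {}" by simp
  ultimately obtain z where z: "z \<in> sphere 0 1" "\<And>x. x \<in> sphere 0 1 \<Longrightarrow> N z \<le> N x"
    using continuous_attains_inf[OF compact_sphere] by blast
  have "z \<noteq> 0" using z(1) by auto
  then have Nz: "N z > 0" using N0[of z] N_eq0[of z] by linarith
  have lower: "\<bar>x $ k\<bar> \<le> 1 / N z * N x" for x k
  proof (cases "x = 0")
    case True
    then show ?thesis using \<open>N 0 = 0\<close> by simp
  next
    case False
    have "N z \<le> N ((1 / norm x) *\<^sub>R x)" using False by (intro z(2)) simp
    then have "norm x \<le> 1 / N z * N x" using False Nz by (simp add: N_scale field_simps)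
    then show ?thesis using component_le_norm_cart[of x k] by linarith
  qed
  show thesis using that[of "1 / N z" C] Nz \<open>C > 0\<close> lower upper by simp
qed

text \<open>Subtracting the equilibrium equation cancels the constant input and leaves differences of
  activations, which the Lipschitz condition controls.  The embedding \<open>\<iota>\<close> selects the layer that feeds
  component \<open>k\<close>, so that both layers of the network are covered.\<close>

lemma network_error_delayed_feedback:
  fixes Z :: "real \<Rightarrow> real^'m" and \<iota> :: "'n::finite \<Rightarrow> 'm"
  assumes "inj \<iota>"
    and der: "((\<lambda>s. Z s $ k) has_real_derivative
        \<rho> * (- d k * Z \<theta> $ k + (\<Sum>j\<in>UNIV. c j * f j (Z (l j) $ \<iota> j)) + I)) (at t)"
    and eq: "d k * Zs $ k = (\<Sum>j\<in>UNIV. c j * f j (Zs $ \<iota> j)) + I"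
    and lip: "\<And>j x y. \<bar>f j x - f j y\<bar> \<le> L j * \<bar>x - y\<bar>"
    and w: "\<And>j. w k (\<iota> j) = \<bar>c j\<bar> * L j" "\<And>j. w k j \<ge> 0"
    and \<rho>: "\<alpha> k \<le> \<rho>" "\<rho> \<le> R k" and \<theta>: "t - \<tau> k \<le> \<theta>" "\<theta> \<le> t"
    and l: "\<And>j. t - \<sigma> \<le> l j" "\<And>j. l j \<le> t" and "\<sigma> \<ge> 0"
  shows "delayed_feedback d \<alpha> R w \<tau> \<sigma> (\<lambda>t. Z t - Zs) k t"
proof -
  define F where "F = (\<Sum>j\<in>UNIV. c j * (f j (Z (l j) $ \<iota> j) - f j (Zs $ \<iota> j)))"
  \<comment> \<open>The feedback condition asks for a time for every component; outside the feeding layer, t itself is a legal one.\<close>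
  define l' where "l' i = (if i \<in> range \<iota> then l (inv \<iota> i) else t)" for i
  have l': "l' (\<iota> j) = l j" for j using \<open>inj \<iota>\<close> by (simp add: l'_def)
  have "\<bar>F\<bar> \<le> (\<Sum>j\<in>UNIV. \<bar>c j\<bar> * \<bar>f j (Z (l j) $ \<iota> j) - f j (Zs $ \<iota> j)\<bar>)"
    unfolding F_def by (rule order_trans[OF sum_abs]) (simp add: abs_mult)
  also have "\<dots> \<le> (\<Sum>j\<in>UNIV. \<bar>c j\<bar> * (L j * \<bar>Z (l j) $ \<iota> j - Zs $ \<iota> j\<bar>))"
    by (intro sum_mono mult_left_mono lip) auto
  also have "\<dots> = (\<Sum>j\<in>UNIV. w k (\<iota> j) * \<bar>(Z (l' (\<iota> j)) - Zs) $ \<iota> j\<bar>)"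
    by (simp add: w(1) l' mult.assoc)
  also have "\<dots> = (\<Sum>i\<in>range \<iota>. w k i * \<bar>(Z (l' i) - Zs) $ i\<bar>)"
    by (simp add: sum.reindex[OF \<open>inj \<iota>\<close>])
  also have "\<dots> \<le> (\<Sum>i\<in>UNIV. w k i * \<bar>(Z (l' i) - Zs) $ i\<bar>)"
    using w(2) by (intro sum_mono2) auto
  finally have F: "\<bar>F\<bar> \<le> (\<Sum>i\<in>UNIV. w k i * \<bar>(Z (l' i) - Zs) $ i\<bar>)" .
  have "- d k * Z \<theta> $ k + (\<Sum>j\<in>UNIV. c j * f j (Z (l j) $ \<iota> j)) + I = - d k * (Z \<theta> - Zs) $ k + F"
    using eq by (simp add: F_def right_diff_distrib sum_subtractf)
  with der have "((\<lambda>s. (Z s - Zs) $ k) has_real_derivative \<rho> * (- d k * (Z \<theta> - Zs) $ k + F)) (at t)"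
    by (auto intro!: derivative_eq_intros)
  moreover have "\<forall>j. t - \<sigma> \<le> l' j \<and> l' j \<le> t" using l \<open>\<sigma> \<ge> 0\<close> by (auto simp: l'_def)
  ultimately show ?thesis using F \<rho> \<theta> unfolding delayed_feedback_def by blast
qed

text \<open>The half-line is not a null set.  This yields \<open>\<alpha> i \<le> R i\<close>, which is only implicit in the
  almost everywhere bounds on the rates.\<close>

lemma AE_lebesgue_on_nonneg_witness:
  assumes "AE t in lebesgue_on {0::real..}. P t"
  shows "\<exists>t. P t"
proof (rule ccontr)
  assume "\<nexists>t. P t"
  then have "AE t in lebesgue. t < (0::real)"
    using assms by (simp add: AE_restrict_space_iff not_le)
  then obtain N where "negligible N" "{t::real. \<not> t < 0} \<subseteq> N"
    unfolding eventually_ae_filter_negligible by blast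
  then have "negligible N" "{0..1::real} \<subseteq> N" by force+
  then have "negligible {0..1::real}" by (rule negligible_subset)
  then show False using negligible_interval(1)[of "0::real" 1] by simp
qed

definition two_layer_weights ::
  "('n \<Rightarrow> 'n \<Rightarrow> real) \<Rightarrow> ('n \<Rightarrow> 'n \<Rightarrow> real) \<Rightarrow> ('n \<Rightarrow> real) \<Rightarrow> ('n \<Rightarrow> real) \<Rightarrow> 'n + 'n \<Rightarrow> 'n + 'n \<Rightarrow> real" where
  "two_layer_weights A B Lf Lg k j = (case (k, j) of
      (Inl i, Inr j) \<Rightarrow> \<bar>A i j\<bar> * Lf j | (Inr i, Inl j) \<Rightarrow> \<bar>B i j\<bar> * Lg j | _ \<Rightarrow> 0)"

lemma C_BAM_entry:
  "C_BAM a b A B \<alpha> R \<beta> P Lf Lg \<tau>1 \<tau>2 $ k $ j =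
     (if k = j then 1 - case_sum a b k * (case_sum R P k)\<^sup>2 * case_sum \<tau>1 \<tau>2 k / case_sum \<alpha> \<beta> k else 0)
     - two_layer_weights A B Lf Lg k j * case_sum R P k
       * (case_sum a b k * case_sum R P k * case_sum \<tau>1 \<tau>2 k + 1) / (case_sum \<alpha> \<beta> k * case_sum a b k)"
  by (cases k; cases j) (auto simp: C_BAM_def two_layer_weights_def)

text \<open>One row of \<open>C\<^sub>B\<^sub>A\<^sub>M \<xi> > 0\<close>, with \<open>x\<close> for \<open>\<xi>\<^sub>k\<close> and \<open>q\<close> for the weighted input, multiplied by
  \<open>\<alpha> d\<close>.  Since \<open>R \<ge> \<alpha>\<close>, replacing \<open>\<alpha> d x\<close> by \<open>R d x\<close> on the larger side lets \<open>R\<close> cancel.\<close>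

lemma positive_vector_dominance:
  fixes d \<alpha> R \<tau> x q :: real
  assumes "d > 0" "\<alpha> > 0" "\<alpha> \<le> R" "x > 0"
    and pos: "(1 - d * R\<^sup>2 * \<tau> / \<alpha>) * x - q * R * (d * R * \<tau> + 1) / (\<alpha> * d) > 0"
  shows "d * R * \<tau> * (d * x + q) + q < d * x"
proof -
  have "R > 0" using assms by simp
  have "0 < (\<alpha> * d) * ((1 - d * R\<^sup>2 * \<tau> / \<alpha>) * x - q * R * (d * R * \<tau> + 1) / (\<alpha> * d))"
    using assms by (intro mult_pos_pos) auto
  also have "\<dots> = \<alpha> * (d * x) - R * (d * R * \<tau> * (d * x + q) + q)"
    using assms(1,2) by (simp add: field_simps power2_eq_square)
  finally have "R * (d * R * \<tau> * (d * x + q) + q) < \<alpha> * (d * x)" by simp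
  also have "\<dots> \<le> R * (d * x)" using assms by (intro mult_right_mono) auto
  finally show ?thesis using \<open>R > 0\<close> by simp
qed

theorem theorem3p3:
  fixes r p :: "'n::finite \<Rightarrow> real \<Rightarrow> real"
    and a b I J :: "'n \<Rightarrow> real"
    and A B :: "'n \<Rightarrow> 'n \<Rightarrow> real"
    and f g :: "'n \<Rightarrow> real \<Rightarrow> real"
    and h1 h2 l1 l2 :: "'n \<Rightarrow> real \<Rightarrow> real"
    and \<alpha> R \<beta> P Lf Lg :: "'n \<Rightarrow> real"
    and \<tau>1 \<tau>2 \<sigma>1 \<sigma>2 :: "'n \<Rightarrow> real"
    and N :: "real^('n + 'n) \<Rightarrow> real"
    and Zs :: "real^('n + 'n)"
  assumes "\<And>i. a i > 0" and "\<And>i. b i > 0"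
    and "\<And>i. r i \<in> borel_measurable (lebesgue_on {0..})"
    and "\<And>i. p i \<in> borel_measurable (lebesgue_on {0..})"
    and "\<And>i. \<alpha> i > 0" and "\<And>i. \<beta> i > 0"
    and "\<And>i. AE t in lebesgue_on {0..}. \<alpha> i \<le> r i t \<and> r i t \<le> R i"
    and "\<And>i. AE t in lebesgue_on {0..}. \<beta> i \<le> p i t \<and> p i t \<le> P i"
    and "\<And>j u v. \<bar>f j u - f j v\<bar> \<le> Lf j * \<bar>u - v\<bar>"
    and "\<And>j u v. \<bar>g j u - g j v\<bar> \<le> Lg j * \<bar>u - v\<bar>"
    and "\<And>i. h1 i \<in> borel_measurable (lebesgue_on {0..})"
    and "\<And>i. h2 i \<in> borel_measurable (lebesgue_on {0..})"
    and "\<And>i. l1 i \<in> borel_measurable (lebesgue_on {0..})"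
    and "\<And>i. l2 i \<in> borel_measurable (lebesgue_on {0..})"
    and "\<And>i t. t \<ge> 0 \<Longrightarrow> 0 \<le> t - h1 i t \<and> t - h1 i t \<le> \<tau>1 i"
    and "\<And>i t. t \<ge> 0 \<Longrightarrow> 0 \<le> t - h2 i t \<and> t - h2 i t \<le> \<tau>2 i"
    and "\<And>i t. t \<ge> 0 \<Longrightarrow> 0 \<le> t - l1 i t \<and> t - l1 i t \<le> \<sigma>1 i"
    and "\<And>i t. t \<ge> 0 \<Longrightarrow> 0 \<le> t - l2 i t \<and> t - l2 i t \<le> \<sigma>2 i"
    and "is_norm N"
    and "bam_equilibrium a b A B f g I J Zs"
    and "\<And>Z. bam_equilibrium a b A B f g I J Z \<Longrightarrow> Z = Zs"
    and "M_matrix (C_BAM a b A B \<alpha> R \<beta> P Lf Lg \<tau>1 \<tau>2)"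
  shows "globally_exponentially_stable N (max_delay \<tau>1 \<tau>2 \<sigma>1 \<sigma>2)
           (bam_solution r p a b A B f g I J h1 h2 l1 l2 (max_delay \<tau>1 \<tau>2 \<sigma>1 \<sigma>2)) Zs"
proof -
  define \<sigma> where "\<sigma> = max_delay \<tau>1 \<tau>2 \<sigma>1 \<sigma>2"
  define d where "d = case_sum a b"
  define lo where "lo = case_sum \<alpha> \<beta>"
  define hi where "hi = case_sum R P"
  define \<tau> where "\<tau> = case_sum \<tau>1 \<tau>2"
  define w where "w = two_layer_weights A B Lf Lg"
  note a = assms(1) and b = assms(2) and \<alpha> = assms(5) and \<beta> = assms(6) and r = assms(7) and p = assms(8)
    and f = assms(9) and g = assms(10) and h1 = assms(15) and h2 = assms(16) and l1 = assms(17) and l2 = assms(18)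
    and N = assms(19) and equilibrium = assms(20) and M = assms(22)
  have delay_le: "\<tau>1 i \<le> \<sigma>" "\<tau>2 i \<le> \<sigma>" "\<sigma>1 i \<le> \<sigma>" "\<sigma>2 i \<le> \<sigma>" for i
    unfolding \<sigma>_def max_delay_def by (auto intro!: Max_ge)
  \<comment> \<open>Time 0 belongs to the domain of the delay bounds, so the leakage bounds are nonnegative.\<close>
  have delay_ge: "0 \<le> \<tau>1 i" "0 \<le> \<tau>2 i" for i
    using h1[of 0 i] h2[of 0 i] by auto
  have "0 \<le> \<sigma>" using delay_le delay_ge order_trans by blast
  have Lf: "0 \<le> Lf j" and Lg: "0 \<le> Lg j" for j
    using f[of j 1 0] g[of j 1 0] by (auto intro: order_trans[OF abs_ge_zero])
  have d: "d k > 0" for k using a b by (cases k) (auto simp: d_def)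
  have lo: "lo k > 0" for k using \<alpha> \<beta> by (cases k) (auto simp: lo_def)
  have lohi: "lo k \<le> hi k" for k
  proof (cases k)
    case (Inl i)
    then show ?thesis using AE_lebesgue_on_nonneg_witness[OF r[of i]] by (auto simp: lo_def hi_def)
  next
    case (Inr i)
    then show ?thesis using AE_lebesgue_on_nonneg_witness[OF p[of i]] by (auto simp: lo_def hi_def)
  qed
  have w: "w k j \<ge> 0" for k j
    using Lf Lg by (auto simp: w_def two_layer_weights_def split: sum.split)
  have \<tau>: "0 \<le> \<tau> k" "\<tau> k \<le> \<sigma>" for k
    using delay_ge delay_le by (auto simp: \<tau>_def split: sum.split)
  obtain \<xi> where \<xi>: "\<And>k. \<xi> k > 0"
    and C\<xi>: "\<And>k. (\<Sum>j\<in>UNIV. C_BAM a b A B \<alpha> R \<beta> P Lf Lg \<tau>1 \<tau>2 $ k $ j * \<xi> j) > 0"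
    using M_matrix_positive_vector[OF M] by blast
  have dominance: "d k * hi k * \<tau> k * (d k * \<xi> k + (\<Sum>j\<in>UNIV. w k j * \<xi> j)) + (\<Sum>j\<in>UNIV. w k j * \<xi> j)
      < d k * \<xi> k" for k
  proof (rule positive_vector_dominance[OF d lo lohi \<xi>])
    have "(\<Sum>j\<in>UNIV. C_BAM a b A B \<alpha> R \<beta> P Lf Lg \<tau>1 \<tau>2 $ k $ j * \<xi> j) =
        (\<Sum>j\<in>UNIV. (if k = j then (1 - d k * (hi k)\<^sup>2 * \<tau> k / lo k) * \<xi> j else 0)
          - w k j * \<xi> j * (hi k * (d k * hi k * \<tau> k + 1) / (lo k * d k)))"
      by (intro sum.cong refl) (simp add: C_BAM_entry d_def lo_def hi_def \<tau>_def w_def algebra_simps)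
    also have "\<dots> = (1 - d k * (hi k)\<^sup>2 * \<tau> k / lo k) * \<xi> k
        - (\<Sum>j\<in>UNIV. w k j * \<xi> j) * (hi k * (d k * hi k * \<tau> k + 1) / (lo k * d k))"
      by (simp add: sum_subtractf sum_distrib_right sum_divide_distrib)
    finally show "0 < (1 - d k * (hi k)\<^sup>2 * \<tau> k / lo k) * \<xi> k
        - (\<Sum>j\<in>UNIV. w k j * \<xi> j) * hi k * (d k * hi k * \<tau> k + 1) / (lo k * d k)"
      using C\<xi>[of k] by (simp add: mult.assoc)
  qed
  obtain K \<mu> where K: "K > 0" and \<mu>: "\<mu> > 0" and decay:
    "\<And>t0 u H t k. \<lbrakk>\<And>T. T \<ge> t0 \<Longrightarrow> absolutely_continuous_fun_on {t0..T} u;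
       AE t in lebesgue. t > t0 \<longrightarrow> (\<forall>k. delayed_feedback d lo hi w \<tau> \<sigma> u k t);
       \<And>s k. t0 - \<sigma> \<le> s \<Longrightarrow> s \<le> t0 \<Longrightarrow> \<bar>u s $ k\<bar> \<le> H; t0 \<le> t\<rbrakk>
       \<Longrightarrow> \<bar>u t $ k\<bar> \<le> K * H * exp (- \<mu> * (t - t0))"
    using delayed_feedback_exponential_decay[OF d lo lohi w \<tau> \<xi> dominance] by blast
  obtain c C where c: "c > 0" and C: "C > 0" and N_lower: "\<And>x k. \<bar>x $ k\<bar> \<le> c * N x"
    and N_upper: "\<And>x B. (\<And>k. \<bar>x $ k\<bar> \<le> B) \<Longrightarrow> N x \<le> C * B"
    using is_norm_equivalent_to_components[OF N] by blast
  have N0: "N x \<ge> 0" for x using N by (simp add: is_norm_def)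
  have gains: "AE t in lebesgue. t \<ge> 0 \<longrightarrow> (\<forall>i. \<alpha> i \<le> r i t \<and> r i t \<le> R i \<and> \<beta> i \<le> p i t \<and> p i t \<le> P i)"
  proof -
    have "AE t in lebesgue. \<forall>i. t \<ge> 0 \<longrightarrow> \<alpha> i \<le> r i t \<and> r i t \<le> R i \<and> \<beta> i \<le> p i t \<and> p i t \<le> P i"
    proof (rule eventually_all_finite)
      fix i
      show "AE t in lebesgue. t \<ge> 0 \<longrightarrow> \<alpha> i \<le> r i t \<and> r i t \<le> R i \<and> \<beta> i \<le> p i t \<and> p i t \<le> P i"
        using r[of i] p[of i] by (simp add: AE_restrict_space_iff imp_conjR)
    qed
    then show ?thesis by eventually_elim blast
  qed
  have bound: "N (Z t - Zs) \<le> C * K * c * exp (- \<mu> * (t - t0)) *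
      (N (Z t0 - Zs) + (if {t0 - \<sigma>..<t0} = {} then 0 else (SUP s\<in>{t0 - \<sigma>..<t0}. N (\<phi> s - Zs))))"
    if t0: "0 \<le> t0" and \<phi>: "continuous_on {t0 - \<sigma>..t0} \<phi>"
      and sol: "bam_solution r p a b A B f g I J h1 h2 l1 l2 \<sigma> t0 \<phi> Z" and t: "t0 \<le> t"
    for t0 \<phi> Z t
  proof -
    define S where "S = (if {t0 - \<sigma>..<t0} = {} then 0 else (SUP s\<in>{t0 - \<sigma>..<t0}. N (\<phi> s - Zs)))"
    \<comment> \<open>The supremum over the half-open interval is an upper bound only because the continuous initial function is bounded.\<close>
    have bdd: "bdd_above ((\<lambda>s. N (\<phi> s - Zs)) ` {t0 - \<sigma>..<t0})"
    proof -
      have "bounded ((\<lambda>s. \<phi> s - Zs) ` {t0 - \<sigma>..t0})"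
        by (intro compact_imp_bounded compact_continuous_image continuous_intros \<phi> compact_Icc)
      then obtain G where G: "\<And>s. s \<in> {t0 - \<sigma>..t0} \<Longrightarrow> norm (\<phi> s - Zs) \<le> G"
        unfolding bounded_iff by blast
      have "N (\<phi> s - Zs) \<le> C * G" if "s \<in> {t0 - \<sigma>..<t0}" for s
      proof (rule N_upper)
        have "norm (\<phi> s - Zs) \<le> G" using that by (intro G) auto
        then show "\<bar>(\<phi> s - Zs) $ k\<bar> \<le> G" for k
          using component_le_norm_cart[of "\<phi> s - Zs" k] by linarith
      qed
      then show ?thesis by (intro bdd_aboveI[of _ "C * G"]) auto
    qed
    have S_upper: "N (\<phi> s - Zs) \<le> S" if "t0 - \<sigma> \<le> s" "s < t0" for s
    proof -
      have "s \<in> {t0 - \<sigma>..<t0}" using that by simp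
      moreover from this have "{t0 - \<sigma>..<t0} \<noteq> {}" by blast
      ultimately show ?thesis unfolding S_def using cSUP_upper[OF _ bdd] by simp
    qed
    have "S \<ge> 0"
    proof (cases "\<sigma> = 0")
      case True
      then show ?thesis by (simp add: S_def)
    next
      case False
      then show ?thesis using S_upper[of "t0 - \<sigma>"] N0[of "\<phi> (t0 - \<sigma>) - Zs"] \<open>0 \<le> \<sigma>\<close> by simp
    qed
    have Z_init: "Z s = \<phi> s" if "t0 - \<sigma> \<le> s" "s \<le> t0" for s
      using sol that by (simp add: bam_solution_def)
    have "\<bar>(Z t - Zs) $ k\<bar> \<le> K * (c * (N (Z t0 - Zs) + S)) * exp (- \<mu> * (t - t0))" for k
    proof (rule decay[OF _ _ _ t])
      fix T assume "t0 \<le> T"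
      then have "absolutely_continuous_fun_on {t0..T} Z"
        using sol by (simp add: bam_solution_def locally_absolutely_continuous_from_def)
      then show "absolutely_continuous_fun_on {t0..T} (\<lambda>t. Z t - Zs)"
        by (rule absolutely_continuous_fun_on_diff) (rule absolutely_continuous_fun_on_lipschitz[where L = 0], simp)
    next
      fix s k assume s: "t0 - \<sigma> \<le> s" "s \<le> t0"
      have "N (Z s - Zs) \<le> N (Z t0 - Zs) + S"
      proof (cases "s = t0")
        case True
        then show ?thesis using \<open>S \<ge> 0\<close> by simp
      next
        case False
        then show ?thesis using S_upper[of s] Z_init[OF s] s N0[of "Z t0 - Zs"] by simp
      qed
      then have "c * N (Z s - Zs) \<le> c * (N (Z t0 - Zs) + S)" using c by (intro mult_left_mono) auto
      then show "\<bar>(Z s - Zs) $ k\<bar> \<le> c * (N (Z t0 - Zs) + S)" using N_lower[of "Z s - Zs" k] by linarith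
    next
      have "AE t in lebesgue. t > t0 \<longrightarrow>
        (\<forall>i. ((\<lambda>s. Z s $ Inl i) has_real_derivative
               r i t * (- a i * Z (h1 i t) $ Inl i
                        + (\<Sum>j\<in>UNIV. A i j * f j (Z (l2 j t) $ Inr j)) + I i)) (at t)) \<and>
        (\<forall>i. ((\<lambda>s. Z s $ Inr i) has_real_derivative
               p i t * (- b i * Z (h2 i t) $ Inr i
                        + (\<Sum>j\<in>UNIV. B i j * g j (Z (l1 j t) $ Inl j)) + J i)) (at t))"
        using sol unfolding bam_solution_def by blast
      then show "AE t in lebesgue. t > t0 \<longrightarrow> (\<forall>k. delayed_feedback d lo hi w \<tau> \<sigma> (\<lambda>t. Z t - Zs) k t)"
        using gains
      proof eventually_elim
        case (elim t)
        show ?case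
        proof (intro impI allI)
          fix k assume "t0 < t"
          then have "t \<ge> 0" using t0 by simp
          have lag1: "t - \<sigma> \<le> l1 j t" "l1 j t \<le> t" and lag2: "t - \<sigma> \<le> l2 j t" "l2 j t \<le> t" for j
            using l1[OF \<open>t \<ge> 0\<close>, of j] l2[OF \<open>t \<ge> 0\<close>, of j] delay_le(3,4)[of j] by auto
          show "delayed_feedback d lo hi w \<tau> \<sigma> (\<lambda>t. Z t - Zs) k t"
          proof (cases k)
            case (Inl i)
            show ?thesis unfolding Inl
            proof (rule network_error_delayed_feedback[where \<iota> = Inr and c = "A i" and f = f and L = Lf
                  and l = "\<lambda>j. l2 j t" and \<rho> = "r i t" and \<theta> = "h1 i t" and I = "I i"])
              show "t - \<tau> (Inl i) \<le> h1 i t" "h1 i t \<le> t"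
                using h1[OF \<open>t \<ge> 0\<close>, of i] by (auto simp: \<tau>_def)
              show "0 \<le> w (Inl i) j" for j by (rule w)
            qed (use elim \<open>t0 < t\<close> \<open>t \<ge> 0\<close> equilibrium f lag2 \<open>0 \<le> \<sigma>\<close> in
                \<open>auto simp: d_def lo_def hi_def w_def two_layer_weights_def bam_equilibrium_def\<close>)
          next
            case (Inr i)
            show ?thesis unfolding Inr
            proof (rule network_error_delayed_feedback[where \<iota> = Inl and c = "B i" and f = g and L = Lg
                  and l = "\<lambda>j. l1 j t" and \<rho> = "p i t" and \<theta> = "h2 i t" and I = "J i"])
              show "t - \<tau> (Inr i) \<le> h2 i t" "h2 i t \<le> t"
                using h2[OF \<open>t \<ge> 0\<close>, of i] by (auto simp: \<tau>_def)
              show "0 \<le> w (Inr i) j" for j by (rule w)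
            qed (use elim \<open>t0 < t\<close> \<open>t \<ge> 0\<close> equilibrium g lag1 \<open>0 \<le> \<sigma>\<close> in
                \<open>auto simp: d_def lo_def hi_def w_def two_layer_weights_def bam_equilibrium_def\<close>)
          qed
        qed
      qed
    qed
    then have "N (Z t - Zs) \<le> C * (K * (c * (N (Z t0 - Zs) + S)) * exp (- \<mu> * (t - t0)))"
      by (rule N_upper)
    then show ?thesis unfolding S_def[symmetric] by (simp only: ac_simps)
  qed
  have "C * K * c > 0" using C K c by simp
  show ?thesis
    unfolding globally_exponentially_stable_def \<sigma>_def[symmetric]
    by (rule exI[of _ "C * K * c"], rule conjI[OF \<open>C * K * c > 0\<close>], rule exI[of _ \<mu>])
      (use \<mu> bound in blast)
qed

end
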